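(* Let $(r_n)_{n\ge 1}$ be a sequence of radii with $r_n \geq 4^{n/5}$ for all $n$. Then $(r_n)$ is undercooked, i.e. there is a constant $C>0$ independent of $n$ such that $\mathrm{Fav}_{\sigma^{(n)}}(\mathcal{K}_n)\geq C\,\frac{\log n}{n}$ for all $n\ge 2$, where $\sigma^{(n)}$ is the map $\sigma$ built from $f_{r_n}$ as described in the context.
   Context: Middle-half Cantor set: $\mathcal{C}_0=[0,1]$ and $\mathcal{C}_{n+1}$ is obtained from $\mathcal{C}_n$ by replacing each of its intervals by the first and last quarters of that interval (removing the middle half). Thus $\mathcal{C}_n$ is a union of $2^n$ intervals of length $4^{-n}$, and $\mathcal{K}_n:=\mathcal{C}_n\times\mathcal{C}_n\subset\mathbb{R}^2=\mathbb{C}$ is a union of $4^n$ closed squares of side $4^{-n}$. For an angle $\theta$, $\mathrm{Proj}_\theta$ denotes orthogonal projection onto the line through the origin in direction $e^{i\theta}$, and $|\cdot|$ denotes one-dimensional Lebesgue measure on that line. For a map $T:\mathbb{C}\times S^1\to\mathbb{C}$ write $T_\theta(z):=T(z,e^{i\theta})$ and define, for $E\subset\mathbb{C}$, $\mathrm{Fav}_T(E):=\frac{1}{2\pi}\int_0^{2\pi}|\mathrm{Proj}_\theta(T_\theta(E))|\,d\theta$. For $r>0$ define $f_r(y):=r-\sqrt{r^2-y^2}$ if $|y|\le 2$ and $f_r(y):=r-\sqrt{r^2-4}$ otherwise. Let $\sigma_0(x,y):=(x-f_r(y),y)$, let $R_\theta$ be clockwise rotation of the plane by the angle $\theta$, and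 set $\sigma_\theta:=R_{-\theta}\circ\sigma_0\circ R_\theta$; this defines $\sigma:\mathbb{C}\times S^1\to\mathbb{C}$ by $\sigma(z,e^{i\theta})=\sigma_\theta(z)$. A sequence of maps $T_n:\mathbb{C}\times S^1\to\mathbb{C}$ is an undercooking of the plane if there is $C>0$ independent of $n$ with $\mathrm{Fav}_{T_n}(\mathcal{K}_n)\ge C\frac{\log n}{n}$; a sequence $(r_n)$ is undercooked if the maps $\sigma$ built from $f_{r_n}$ form an undercooking. *)

theory Defs
  imports "HOL-Analysis.Analysis"
begin

text \<open>Left endpoints of the 2^n intervals (each of length 4^-n) making up the n-th
  stage of the middle-half Cantor set.  Each interval [a, a + 4^-n] is replaced by its
  first quarter [a, a + 4^-(n+1)] and its last quarter [a + 3*4^-(n+1), a + 4^-n].\<close>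
fun cantor_left :: "nat \<Rightarrow> real set" where
  "cantor_left 0 = {0}"
| "cantor_left (Suc n) =
     (\<Union>a\<in>cantor_left n. {a, a + 3 * (1/4) ^ Suc n})"

definition cantor_stage :: "nat \<Rightarrow> real set" where
  "cantor_stage n = (\<Union>a\<in>cantor_left n. {a .. a + (1/4) ^ n})"

definition K_stage :: "nat \<Rightarrow> complex set" where
  "K_stage n = {z. Re z \<in> cantor_stage n \<and> Im z \<in> cantor_stage n}"

text \<open>Coordinate of the orthogonal projection onto the line through 0 in direction
  e^{i theta}: Proj_theta z = proj_coord theta z * e^{i theta}.  Lebesgue measure on that
  line is transported isometrically to Lebesgue measure on the real line.\<close>
definition proj_coord :: "real \<Rightarrow> complex \<Rightarrow> real" where
  "proj_coord \<theta> z = Re (z * cnj (cis \<theta>))"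

definition proj_length :: "real \<Rightarrow> complex set \<Rightarrow> real" where
  "proj_length \<theta> S = measure lebesgue (proj_coord \<theta> ` S)"

definition Fav :: "(complex \<Rightarrow> complex \<Rightarrow> complex) \<Rightarrow> complex set \<Rightarrow> real" where
  "Fav T E = (1 / (2 * pi)) *
     integral {0 .. 2 * pi} (\<lambda>\<theta>. proj_length \<theta> ((\<lambda>z. T z (cis \<theta>)) ` E))"

definition f_r :: "real \<Rightarrow> real \<Rightarrow> real" where
  "f_r r y = (if \<bar>y\<bar> \<le> 2 then r - sqrt (r\<^sup>2 - y\<^sup>2) else r - sqrt (r\<^sup>2 - 4))"

definition sigma0 :: "real \<Rightarrow> complex \<Rightarrow> complex" where
  "sigma0 r w = Complex (Re w - f_r r (Im w)) (Im w)"

definition rot_cw :: "real \<Rightarrow> complex \<Rightarrow> complex" where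
  "rot_cw \<theta> z = cis (- \<theta>) * z"

text \<open>sigma_theta = R_{-theta} o sigma_0 o R_theta, and sigma(z, e^{i theta}) = sigma_theta(z).
  The second argument u is a point of the unit circle, u = e^{i theta}; we take theta = arg u.\<close>
definition sigma_map :: "real \<Rightarrow> complex \<Rightarrow> complex \<Rightarrow> complex" where
  "sigma_map r z u = rot_cw (- Arg u) (sigma0 r (rot_cw (Arg u) z))"

definition undercooking :: "(nat \<Rightarrow> complex \<Rightarrow> complex \<Rightarrow> complex) \<Rightarrow> bool" where
  "undercooking T \<longleftrightarrow>
     (\<exists>C>0. \<forall>n\<ge>2. Fav (T n) (K_stage n) \<ge> C * ln (real n) / real n)"

definition undercooked :: "(nat \<Rightarrow> real) \<Rightarrow> bool" where
  "undercooked r \<longleftrightarrow> undercooking (\<lambda>n. sigma_map (r n))"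

end

theory Submission
  imports Defs
begin

text \<open>
  A second moment argument near the angle \<open>\<theta>\<^sub>0 = arctan (1/2)\<close>, at which the linear projections of the
  \<open>4\<^sup>n\<close> squares tile an interval in the order of their base 4 addresses. Consider angles within
  \<open>4\<^sup>-\<^sup>k\<close> of \<open>\<theta>\<^sub>0\<close>, where \<open>4\<^sup>k \<le> n\<close>. If the addresses of two squares first differ at the digit of weight
  \<open>4\<^sup>i\<close>, their projections can only meet when the addresses differ by \<open>O(1 + 4\<^sup>i\<^sup>-\<^sup>k)\<close>, hence lie that close to a
  common multiple of \<open>4\<^sup>i\<close>; and then they meet for a set of angles of measure \<open>O(4\<^sup>-\<^sup>i)\<close>, by transversality.
  Summing over pairs bounds the integral of the squared multiplicity by \<open>O(n 16\<^sup>-\<^sup>k)\<close>, so by Cauchy--Schwarz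
  the angles at distance between \<open>4\<^sup>-\<^sup>k\<^sup>-\<^sup>1\<close> and \<open>4\<^sup>-\<^sup>k\<close> contribute at least \<open>c / n\<close>. There are about \<open>log n\<close>
  such \<open>k\<close>. The curvature perturbs a projected difference vector by a factor \<open>O(1/r)\<close> only, which is
  harmless as soon as \<open>1/r = O(4\<^sup>-\<^sup>k)\<close>.
\<close>

subsection \<open>Addresses of the squares\<close>

text \<open>A base 4 digit encodes two bits, \<open>q div 2\<close> for the first and \<open>q mod 2\<close> for the second coordinate.
  With \<open>b\<close> selecting one of them, \<open>spread b m / 4\<^sup>n\<close> is a coordinate of the lower left corner of the square
  with address \<open>m < 4\<^sup>n\<close>.\<close>
fun spread :: "(nat \<Rightarrow> nat) \<Rightarrow> nat \<Rightarrow> nat" where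
  "spread b m = (if m = 0 then 0 else 4 * spread b (m div 4) + 3 * b (m mod 4))"

declare spread.simps [simp del]

text \<open>Only digits below 4 have to go to bits, since \<open>q div 2\<close> leaves
  \<open>{0, 1}\<close> beyond them; \<open>b 0 = 0\<close> lets the recursion of
  \<open>spread\<close> hold at \<open>m = 0\<close> too.\<close>

definition bit_selector :: "(nat \<Rightarrow> nat) \<Rightarrow> bool" where
  "bit_selector b \<longleftrightarrow> b 0 = 0 \<and> (\<forall>q. b q \<le> 1 \<or> q \<ge> 4)"

lemma bit_selector_div2: "bit_selector (\<lambda>q. q div 2)"
  unfolding bit_selector_def by auto

lemma bit_selector_mod2: "bit_selector (\<lambda>q. q mod 2)"
  unfolding bit_selector_def by auto

lemma spread_0 [simp]: "spread b 0 = 0"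
  by (simp add: spread.simps)

lemma spread_rec:
  assumes "bit_selector b"
  shows "spread b m = 4 * spread b (m div 4) + 3 * b (m mod 4)"
  using assms by (cases "m = 0") (auto simp: spread.simps[of b m] bit_selector_def)

lemma bit_selector_le:
  assumes "bit_selector b"
  shows "b (m mod 4) \<le> 1"
proof -
  have "m mod 4 < 4" by simp
  then show ?thesis using assms unfolding bit_selector_def by (meson linorder_not_less)
qed

lemma spread_less:
  assumes b: "bit_selector b" and "m < 4 ^ i"
  shows "spread b m < 4 ^ i"
  using assms(2)
proof (induction i arbitrary: m)
  case 0
  then show ?case by simp
next
  case (Suc i)
  have "m div 4 < 4 ^ i" using Suc.prems by (simp add: less_mult_imp_div_less mult.commute)
  then have "spread b (m div 4) < 4 ^ i" by (rule Suc.IH)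
  then show ?case
    using bit_selector_le[OF b, of m] by (subst spread_rec[OF b]) simp
qed

text \<open>\<open>spread\<close> acts digit by digit, so the leading digits and the lowest
  \<open>i\<close> digits contribute separately.\<close>

lemma spread_split:
  assumes b: "bit_selector b"
  shows "spread b m = 4 ^ i * spread b (m div 4 ^ i) + spread b (m mod 4 ^ i)"
proof (induction i arbitrary: m)
  case 0
  then show ?case by simp
next
  case (Suc i)
  have 1: "m mod 4 ^ Suc i div 4 = m div 4 mod 4 ^ i"
    by (simp add: mod_mult2_eq)
  have 2: "m mod 4 ^ Suc i mod 4 = m mod 4"
    by (simp add: mod_mod_cancel)
  have 3: "m div 4 div 4 ^ i = m div 4 ^ Suc i"
    by (simp add: div_mult2_eq)
  have "spread b m = 4 * spread b (m div 4) + 3 * b (m mod 4)"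
    by (rule spread_rec[OF b])
  also have "spread b (m div 4) = 4 ^ i * spread b (m div 4 ^ Suc i) + spread b (m div 4 mod 4 ^ i)"
    using Suc.IH[of "m div 4"] unfolding 3 .
  also have "spread b (m mod 4 ^ Suc i) = 4 * spread b (m div 4 mod 4 ^ i) + 3 * b (m mod 4)"
    using spread_rec[OF b, of "m mod 4 ^ Suc i"] unfolding 1 2 .
  then have "4 * (4 ^ i * spread b (m div 4 ^ Suc i) + spread b (m div 4 mod 4 ^ i)) + 3 * b (m mod 4)
      = 4 ^ Suc i * spread b (m div 4 ^ Suc i) + spread b (m mod 4 ^ Suc i)"
    by (simp add: algebra_simps)
  finally show ?case .
qed

lemma spread_mem_cantor_left:
  assumes b: "bit_selector b" and "m < 4 ^ n"
  shows "real (spread b m) / 4 ^ n \<in> cantor_left n"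
  using assms(2)
proof (induction n arbitrary: m)
  case 0
  then show ?case by simp
next
  case (Suc n)
  have "m div 4 < 4 ^ n" using Suc.prems by (simp add: less_mult_imp_div_less mult.commute)
  then have IH: "real (spread b (m div 4)) / 4 ^ n \<in> cantor_left n" by (rule Suc.IH)
  have "real (spread b m) / 4 ^ Suc n
      = real (spread b (m div 4)) / 4 ^ n + real (b (m mod 4)) * (3 * (1/4) ^ Suc n)"
    by (subst spread_rec[OF b]) (simp add: field_simps power_one_over)
  moreover have "b (m mod 4) = 0 \<or> b (m mod 4) = 1"
    using bit_selector_le[OF b, of m] by linarith
  ultimately show ?case using IH by auto
qed

text \<open>A digit \<open>q\<close> contributes
  \<open>3 * (2 * (q div 2) + q mod 2) = 3 * q\<close>. Thus \<open>2 x + y\<close> takes equally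
  spaced values at the corners, which is the source of the tiling.\<close>

lemma spread_sum: "2 * spread (\<lambda>q. q div 2) m + spread (\<lambda>q. q mod 2) m = 3 * m"
proof (induction m rule: less_induct)
  case (less m)
  show ?case
  proof (cases "m = 0")
    case False
    then have "2 * spread (\<lambda>q. q div 2) (m div 4) + spread (\<lambda>q. q mod 2) (m div 4) = 3 * (m div 4)"
      by (intro less) simp
    moreover have "spread (\<lambda>q. q div 2) m = 4 * spread (\<lambda>q. q div 2) (m div 4) + 3 * (m mod 4 div 2)"
      by (rule spread_rec[OF bit_selector_div2])
    moreover have "spread (\<lambda>q. q mod 2) m = 4 * spread (\<lambda>q. q mod 2) (m div 4) + 3 * (m mod 4 mod 2)"
      by (rule spread_rec[OF bit_selector_mod2])
    moreover have "2 * (m mod 4 div 2) + m mod 4 mod 2 = m mod 4" by presburger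
    moreover have "4 * (m div 4) + m mod 4 = m" by presburger
    ultimately show ?thesis by linarith
  qed simp
qed

section \<open>Pairs of addresses sorted by their most significant differing digit\<close>

definition split_at :: "nat \<Rightarrow> nat \<Rightarrow> nat \<Rightarrow> bool" where
  "split_at i m m' \<longleftrightarrow> m div 4 ^ i \<noteq> m' div 4 ^ i \<and> m div 4 ^ Suc i = m' div 4 ^ Suc i"

lemma split_at_exists:
  assumes "m < 4 ^ n" "m' < 4 ^ n" "m \<noteq> m'"
  shows "\<exists>i<n. split_at i m m'"
proof -
  define i where "i = (LEAST i. m div 4 ^ i = m' div 4 ^ i)"
  have n: "m div 4 ^ n = m' div 4 ^ n" using assms by simp
  have i: "m div 4 ^ i = m' div 4 ^ i" unfolding i_def by (rule LeastI[of _ n]) (rule n)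
  have le: "i \<le> n" unfolding i_def by (rule Least_le) (rule n)
  have "i \<noteq> 0" using i assms(3) by (cases i) auto
  then obtain j where j: "i = Suc j" by (cases i) auto
  have "m div 4 ^ j \<noteq> m' div 4 ^ j"
    using not_less_Least[of j "\<lambda>i. m div 4 ^ i = m' div 4 ^ i"] j unfolding i_def[symmetric] by simp
  then have "split_at j m m'" using i j by (simp add: split_at_def)
  then show ?thesis using j le by (intro exI[of _ j]) simp
qed

text \<open>The common digits above position \<open>i\<close> cancel. A differing bit at position
  \<open>i\<close> shifts by \<open>3 * 4 ^ i\<close>, of which the lower digits can undo at most
  \<open>4 ^ i\<close>.\<close>

lemma spread_diff:
  assumes b: "bit_selector b" and s: "m div 4 ^ Suc i = m' div 4 ^ Suc i"
  shows "\<bar>real (spread b m) - real (spread b m')\<bar> \<le> 4 * 4 ^ i"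
    and "b (m div 4 ^ i mod 4) \<noteq> b (m' div 4 ^ i mod 4) \<Longrightarrow>
      2 * 4 ^ i \<le> \<bar>real (spread b m) - real (spread b m')\<bar>"
proof -
  have "spread b (m mod 4 ^ Suc i) < 4 ^ Suc i" "spread b (m' mod 4 ^ Suc i) < 4 ^ Suc i"
    by (rule spread_less[OF b], simp)+
  then have "real (spread b (m mod 4 ^ Suc i)) < real (4 ^ Suc i)"
     "real (spread b (m' mod 4 ^ Suc i)) < real (4 ^ Suc i)"
    by (simp_all only: of_nat_less_iff)
  then show "\<bar>real (spread b m) - real (spread b m')\<bar> \<le> 4 * 4 ^ i"
    using spread_split[OF b, of m "Suc i"] spread_split[OF b, of m' "Suc i"] s by simp
  assume ne: "b (m div 4 ^ i mod 4) \<noteq> b (m' div 4 ^ i mod 4)"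
  have eq: "m div 4 ^ i div 4 = m' div 4 ^ i div 4"
    using s by (simp only: power_Suc2 div_mult2_eq)
  have "real (spread b (m mod 4 ^ i)) < 4 ^ i" for m
  proof -
    have "real (spread b (m mod 4 ^ i)) < real (4 ^ i)"
      unfolding of_nat_less_iff by (rule spread_less[OF b]) simp
    then show ?thesis by simp
  qed
  from this[of m] this[of m'] have
    "\<bar>real (spread b (m mod 4 ^ i)) - real (spread b (m' mod 4 ^ i))\<bar> \<le> 4 ^ i" by linarith
  moreover have "real (spread b m) = 4 ^ i * (4 * spread b (m div 4 ^ i div 4) + 3 * b (m div 4 ^ i mod 4))
      + spread b (m mod 4 ^ i)" for m
    by (subst spread_split[OF b, of m i], subst spread_rec[OF b, of "m div 4 ^ i"]) simp
  from this[of m] this[of m'] eq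
  have "real (spread b m) - real (spread b m') =
      3 * (4 ^ i * (real (b (m div 4 ^ i mod 4)) - real (b (m' div 4 ^ i mod 4))))
      + (real (spread b (m mod 4 ^ i)) - real (spread b (m' mod 4 ^ i)))"
    by (simp add: algebra_simps)
  moreover have "real (b (m div 4 ^ i mod 4)) - real (b (m' div 4 ^ i mod 4)) = 1
      \<or> real (b (m div 4 ^ i mod 4)) - real (b (m' div 4 ^ i mod 4)) = -1"
    using ne bit_selector_le[OF b, of "m div 4 ^ i"] bit_selector_le[OF b, of "m' div 4 ^ i"]
    by (auto simp: le_Suc_eq)
  ultimately show "2 * 4 ^ i \<le> \<bar>real (spread b m) - real (spread b m')\<bar>"
    by (elim disjE) simp_all
qed

definition corner :: "nat \<Rightarrow> nat \<Rightarrow> complex" where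
  "corner n m = Complex (real (spread (\<lambda>q. q div 2) m) / 4 ^ n) (real (spread (\<lambda>q. q mod 2) m) / 4 ^ n)"

lemma corner_norm_le:
  assumes "m < 4 ^ n"
  shows "norm (corner n m) \<le> 2"
proof -
  have "\<bar>real (spread b m) / 4 ^ n\<bar> \<le> 1" if "bit_selector b" for b
  proof -
    have "real (spread b m) < real (4 ^ n)"
      using spread_less[OF that assms] by (simp only: of_nat_less_iff)
    then show ?thesis by simp
  qed
  from this[OF bit_selector_div2] this[OF bit_selector_mod2] show ?thesis
    using cmod_le[of "corner n m"] unfolding corner_def complex.sel by linarith
qed

text \<open>Two different digits differ in one of their two bits, so at least one coordinate obeys
  the lower bound of \<open>spread_diff\<close>.\<close>

lemma corner_diff_norm:
  assumes "split_at i m m'"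
  shows "2 * 4 ^ i / 4 ^ n \<le> norm (corner n m - corner n m')"
    and "norm (corner n m - corner n m') \<le> 8 * 4 ^ i / 4 ^ n"
proof -
  have s: "m div 4 ^ Suc i = m' div 4 ^ Suc i" and ne: "m div 4 ^ i \<noteq> m' div 4 ^ i"
    using assms unfolding split_at_def by auto
  have eq: "m div 4 ^ i div 4 = m' div 4 ^ i div 4"
    using s by (simp only: power_Suc2 div_mult2_eq)
  have R: "Re (corner n m - corner n m') =
      (real (spread (\<lambda>q. q div 2) m) - real (spread (\<lambda>q. q div 2) m')) / 4 ^ n"
    and I: "Im (corner n m - corner n m') =
      (real (spread (\<lambda>q. q mod 2) m) - real (spread (\<lambda>q. q mod 2) m')) / 4 ^ n"
    by (simp_all add: corner_def diff_divide_distrib)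
  have "\<bar>Re (corner n m - corner n m')\<bar> \<le> 4 * 4 ^ i / 4 ^ n"
    "\<bar>Im (corner n m - corner n m')\<bar> \<le> 4 * 4 ^ i / 4 ^ n"
    unfolding R I abs_divide
    using spread_diff(1)[OF bit_selector_div2 s] spread_diff(1)[OF bit_selector_mod2 s]
    by (simp_all add: divide_right_mono)
  then show "norm (corner n m - corner n m') \<le> 8 * 4 ^ i / 4 ^ n"
    using cmod_le[of "corner n m - corner n m'"] by linarith
  have "m div 4 ^ i mod 4 \<noteq> m' div 4 ^ i mod 4"
    using eq ne by (metis div_mult_mod_eq)
  then have "m div 4 ^ i mod 4 div 2 \<noteq> m' div 4 ^ i mod 4 div 2 \<or>
      m div 4 ^ i mod 4 mod 2 \<noteq> m' div 4 ^ i mod 4 mod 2"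
    by (metis div_mult_mod_eq)
  then have "2 * 4 ^ i / 4 ^ n \<le> \<bar>Re (corner n m - corner n m')\<bar> \<or>
      2 * 4 ^ i / 4 ^ n \<le> \<bar>Im (corner n m - corner n m')\<bar>"
    unfolding R I abs_divide
    using spread_diff(2)[OF bit_selector_div2 s] spread_diff(2)[OF bit_selector_mod2 s]
    by (auto simp add: divide_right_mono)
  then show "2 * 4 ^ i / 4 ^ n \<le> norm (corner n m - corner n m')"
    using abs_Re_le_cmod[of "corner n m - corner n m'"] abs_Im_le_cmod[of "corner n m - corner n m'"]
    by linarith
qed

text \<open>For \<open>m < m'\<close> some multiple of \<open>4 ^ i\<close> lies in
  \<open>{m<..m'}\<close>. The pair is recovered from that multiple, which has
  \<open>4 ^ (n - i)\<close> choices, and the distances of \<open>m\<close> and \<open>m'\<close> to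
  it, both at most \<open>M\<close>. The factor 2 accounts for the order.\<close>

lemma card_split_at_le:
  "card {(m, m'). m < 4 ^ n \<and> m' < 4 ^ n \<and> split_at i m m' \<and> \<bar>int m - int m'\<bar> \<le> int M}
    \<le> 2 * (4 ^ (n - i) * (M + 1) ^ 2)" if "i \<le> n"
proof -
  define P where "P = {(m, m'). m < 4 ^ n \<and> m' < 4 ^ n \<and> split_at i m m' \<and> \<bar>int m - int m'\<bar> \<le> int M \<and> m < m'}"
  define B where "B = {..<4 ^ (n - i) :: nat} \<times> {..M} \<times> {..M}"
  \<comment> \<open>By \<open>key\<close>, the natural subtraction does not truncate on
    \<open>P\<close>, so \<open>m\<close> can be read off from it.\<close>
  define \<phi> where "\<phi> = (\<lambda>(m, m'). (m' div 4 ^ i, m' div 4 ^ i * 4 ^ i - m, m' mod 4 ^ i :: nat))"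
  have finP: "finite P"
    by (rule finite_subset[of _ "{..<4 ^ n} \<times> {..<4 ^ n}"]) (auto simp: P_def)
  have key: "m < m' div 4 ^ i * 4 ^ i \<and> m' div 4 ^ i * 4 ^ i \<le> m'" if "(m, m') \<in> P" for m m'
  proof -
    have "m div 4 ^ i < m' div 4 ^ i"
      using that div_le_mono[of m m' "4 ^ i"] unfolding P_def split_at_def by auto
    then show ?thesis
      by (metis div_less_iff_less_mult div_times_less_eq_dividend zero_less_numeral zero_less_power)
  qed
  have "inj_on \<phi> P"
  proof (rule inj_onI, clarify)
    fix m m' l l' assume a: "(m, m') \<in> P" "(l, l') \<in> P" "\<phi> (m, m') = \<phi> (l, l')"
    have "m' = l'" using a(3) unfolding \<phi>_def by (metis (no_types, lifting) case_prod_conv div_mult_mod_eq prod.inject)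
    then show "m = l \<and> m' = l'"
      using a(3) key[OF a(1)] key[OF a(2)] unfolding \<phi>_def by auto
  qed
  moreover have "\<phi> ` P \<subseteq> B"
  proof (rule image_subsetI)
    fix p assume "p \<in> P"
    then obtain m m' where p: "p = (m, m')" and a: "(m, m') \<in> P" by (cases p) auto
    have "m' < 4 ^ (n - i) * 4 ^ i" using a \<open>i \<le> n\<close> by (simp add: P_def flip: power_add)
    then have "m' div 4 ^ i < 4 ^ (n - i)" by (simp add: less_mult_imp_div_less)
    moreover have "int m' - int m \<le> int M" using a by (auto simp: P_def)
    moreover have "m' = m' div 4 ^ i * 4 ^ i + m' mod 4 ^ i" by (simp only: div_mult_mod_eq)
    ultimately show "\<phi> p \<in> B"
      using key[OF a] unfolding p \<phi>_def B_def by auto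
  qed
  ultimately have "card P \<le> card B"
    by (rule card_inj_on_le) (simp add: B_def)
  also have "card B = 4 ^ (n - i) * (M + 1) ^ 2"
    by (simp add: B_def card_cartesian_product power2_eq_square)
  finally have P: "card P \<le> 4 ^ (n - i) * (M + 1) ^ 2" .
  have "{(m, m'). m < 4 ^ n \<and> m' < 4 ^ n \<and> split_at i m m' \<and> \<bar>int m - int m'\<bar> \<le> int M}
      \<subseteq> P \<union> prod.swap ` P" (is "?A \<subseteq> _")
  proof clarify
    fix m m' assume a: "m < 4 ^ n" "m' < 4 ^ n" "split_at i m m'" "\<bar>int m - int m'\<bar> \<le> int M"
       "(m, m') \<notin> prod.swap ` P"
    have "m \<noteq> m'" using a by (auto simp: split_at_def)
    moreover have "(m', m) \<notin> P" using a(5) by (metis image_eqI swap_simp)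
    ultimately show "(m, m') \<in> P" using a by (auto simp: P_def split_at_def)
  qed
  then have "card ?A \<le> card (P \<union> prod.swap ` P)"
    by (rule card_mono[rotated]) (simp add: finP)
  also have "\<dots> \<le> card P + card (prod.swap ` P)" by (rule card_Un_le)
  also have "\<dots> \<le> 2 * card P" using card_image_le[OF finP, of prod.swap] by simp
  finally show ?thesis using P by simp
qed

lemma card_close_pairs_le:
  "card {(m, m'). m < N \<and> m' < N \<and> \<bar>int m - int m'\<bar> \<le> int M} \<le> N * (2 * M + 1)"
proof -
  define \<phi> where "\<phi> = (\<lambda>(m :: nat, m' :: nat). (m, int m' - int m))"
  have "card {(m, m'). m < N \<and> m' < N \<and> \<bar>int m - int m'\<bar> \<le> int M} \<le> card ({..<N} \<times> {- int M..int M})"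
    by (rule card_inj_on_le[of \<phi>]) (auto simp: inj_on_def \<phi>_def)
  also have "\<dots> = N * (2 * M + 1)"
    by (simp add: card_cartesian_product nat_add_distrib nat_mult_distrib)
  finally show ?thesis .
qed

subsection \<open>Curved projections\<close>

text \<open>For \<open>r \<ge> 2\<close> the level sets, where the rotated ordinate is at most 2 in
  absolute value, are arcs of circles of radius \<open>r\<close>; they straighten to the fibres of
  the linear projection as \<open>r\<close> grows.\<close>

definition circ_proj :: "real \<Rightarrow> real \<Rightarrow> complex \<Rightarrow> real" where
  "circ_proj r \<theta> z = Re (cis (- \<theta>) * z) - f_r r (Im (cis (- \<theta>) * z))"

lemma proj_coord_sigma_map: "proj_coord \<theta> (sigma_map r z (cis \<theta>)) = circ_proj r \<theta> z"
proof -
  define w where "w = cis (- \<theta>) * z"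
  \<comment> \<open>\<open>Arg\<close> may return an angle differing from \<open>\<theta>\<close> by
    a multiple of \<open>2 * pi\<close>, but it enters only through \<open>cis\<close>.\<close>
  have A: "cis (Arg (cis \<theta>)) = cis \<theta>"
    by (simp add: cis_Arg)
  then have A': "cis (- Arg (cis \<theta>)) = cis (- \<theta>)"
    by (metis cis_cnj)
  have "proj_coord \<theta> (sigma_map r z (cis \<theta>)) = Re (cis \<theta> * sigma0 r w * cis (- \<theta>))"
    unfolding proj_coord_def sigma_map_def rot_cw_def minus_minus A A' w_def cis_cnj ..
  also have "cis \<theta> * sigma0 r w * cis (- \<theta>) = sigma0 r w * (cis \<theta> * cis (- \<theta>))"
    by (simp only: ac_simps)
  also have "\<dots> = sigma0 r w" by (simp add: cis_mult)
  finally show ?thesis by (simp add: sigma0_def circ_proj_def w_def)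
qed

text \<open>Rotation preserves the norm, so in the disc of radius 2 only the circular branch of
  \<open>f_r\<close> occurs, at every angle.\<close>

lemma circ_proj_eq:
  assumes "norm z \<le> 2"
  shows "circ_proj r \<theta> z = Re (cis (- \<theta>) * z) - r + sqrt (r\<^sup>2 - (Im (cis (- \<theta>) * z))\<^sup>2)"
proof -
  have "\<bar>Im (cis (- \<theta>) * z)\<bar> \<le> norm (cis (- \<theta>) * z)" by (rule abs_Im_le_cmod)
  then have "\<bar>Im (cis (- \<theta>) * z)\<bar> \<le> 2" using assms by (simp add: norm_mult)
  then show ?thesis by (simp add: circ_proj_def f_r_def)
qed

lemma circ_proj_add_ray: "circ_proj r \<theta> (z + of_real t * cis \<theta>) = circ_proj r \<theta> z + t"
proof -
  have "cis (- \<theta>) * (z + of_real t * cis \<theta>) = cis (- \<theta>) * z + of_real t * (cis (- \<theta>) * cis \<theta>)"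
    by (simp only: ring_distribs ac_simps)
  then have "cis (- \<theta>) * (z + of_real t * cis \<theta>) = cis (- \<theta>) * z + of_real t"
    by (simp add: cis_mult)
  then show ?thesis by (simp add: circ_proj_def)
qed

lemma sqrt_ge_half:
  fixes r y :: real
  assumes "r \<ge> 100" "\<bar>y\<bar> \<le> 2"
  shows "sqrt (r\<^sup>2 - y\<^sup>2) \<ge> r / 2" "r\<^sup>2 - y\<^sup>2 > 0"
proof -
  have "y\<^sup>2 \<le> 2\<^sup>2" using assms(2) by (simp only: abs_le_square_iff[symmetric])
  moreover have "r\<^sup>2 \<ge> 100\<^sup>2" using assms(1) by (intro power_mono) auto
  ultimately have *: "(r / 2)\<^sup>2 \<le> r\<^sup>2 - y\<^sup>2" "r\<^sup>2 - y\<^sup>2 > 0" by (auto simp: power_divide)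
  show "r\<^sup>2 - y\<^sup>2 > 0" by fact
  show "sqrt (r\<^sup>2 - y\<^sup>2) \<ge> r / 2" using *(1) by (rule real_le_rsqrt)
qed

text \<open>The difference of the roots is \<open>q\<^sup>2 - p\<^sup>2\<close> over their sum; the
  sum is at least \<open>r\<close>, and \<open>\<bar>p + q\<bar> \<le> 4\<close>.\<close>

lemma sqrt_circle_lipschitz:
  fixes r p q :: real
  assumes r: "r \<ge> 100" and p: "\<bar>p\<bar> \<le> 2" and q: "\<bar>q\<bar> \<le> 2"
  shows "\<bar>sqrt (r\<^sup>2 - p\<^sup>2) - sqrt (r\<^sup>2 - q\<^sup>2)\<bar> \<le> 4 / r * \<bar>p - q\<bar>"
proof -
  define P Q where "P = sqrt (r\<^sup>2 - p\<^sup>2)" and "Q = sqrt (r\<^sup>2 - q\<^sup>2)"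
  have PQ: "P \<ge> r / 2" "Q \<ge> r / 2" "P\<^sup>2 = r\<^sup>2 - p\<^sup>2" "Q\<^sup>2 = r\<^sup>2 - q\<^sup>2"
    using sqrt_ge_half[OF r p] sqrt_ge_half[OF r q] unfolding P_def Q_def by auto
  have "(P - Q) * (P + Q) = (q + p) * (q - p)" using PQ(3,4) by (simp add: algebra_simps power2_eq_square)
  then have "\<bar>P - Q\<bar> * \<bar>P + Q\<bar> = \<bar>q + p\<bar> * \<bar>p - q\<bar>" by (metis abs_minus_commute abs_mult)
  moreover have "\<bar>P - Q\<bar> * r \<le> \<bar>P - Q\<bar> * \<bar>P + Q\<bar>" using PQ r by (intro mult_left_mono) auto
  moreover have "\<bar>q + p\<bar> * \<bar>p - q\<bar> \<le> 4 * \<bar>p - q\<bar>" using p q by (intro mult_right_mono) auto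
  ultimately have "\<bar>P - Q\<bar> * r \<le> 4 * \<bar>p - q\<bar>" by linarith
  then show ?thesis using r unfolding P_def Q_def by (simp add: field_simps)
qed

lemma circle_slope_lipschitz:
  fixes r p q :: real
  assumes r: "r \<ge> 100" and p: "\<bar>p\<bar> \<le> 2" and q: "\<bar>q\<bar> \<le> 2"
  shows "\<bar>p / sqrt (r\<^sup>2 - p\<^sup>2) - q / sqrt (r\<^sup>2 - q\<^sup>2)\<bar> \<le> 3 / r * \<bar>p - q\<bar>"
    and "\<bar>q / sqrt (r\<^sup>2 - q\<^sup>2)\<bar> \<le> 4 / r"
proof -
  define P Q where "P = sqrt (r\<^sup>2 - p\<^sup>2)" and "Q = sqrt (r\<^sup>2 - q\<^sup>2)"
  have PQ: "P \<ge> r / 2" "Q \<ge> r / 2"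
    using sqrt_ge_half[OF r p] sqrt_ge_half[OF r q] unfolding P_def Q_def by auto
  have pos: "P > 0" "Q > 0" using PQ r by auto
  have "\<bar>q\<bar> / Q \<le> 2 / (r / 2)" using PQ q r by (intro frac_le) auto
  then show qQ: "\<bar>q / sqrt (r\<^sup>2 - q\<^sup>2)\<bar> \<le> 4 / r"
    using pos unfolding Q_def[symmetric] by simp
  have PQd: "\<bar>P - Q\<bar> \<le> 4 / r * \<bar>p - q\<bar>"
    using sqrt_circle_lipschitz[OF r p q] unfolding P_def Q_def .
  have invP: "1 / P \<le> 2 / r" using PQ r pos by (simp add: field_simps)
  \<comment> \<open>Varying the numerator and the denominator separately gives a main term
    \<open>2 / r\<close> and an error \<open>32 / r ^ 3\<close>, which is below \<open>1 / r\<close>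
    for \<open>r \<ge> 100\<close>.\<close>
  have "p / P - q / Q = (p - q) * (1 / P) - (q / Q) * ((P - Q) * (1 / P))"
    using pos by (simp add: field_simps)
  then have "\<bar>p / P - q / Q\<bar> \<le> \<bar>p - q\<bar> * (1 / P) + \<bar>q / Q\<bar> * (\<bar>P - Q\<bar> * (1 / P))"
    using abs_triangle_ineq4[of "(p - q) * (1 / P)" "(q / Q) * ((P - Q) * (1 / P))"] pos
    by (simp add: abs_mult)
  also have "\<dots> \<le> \<bar>p - q\<bar> * (2 / r) + (4 / r) * ((4 / r * \<bar>p - q\<bar>) * (2 / r))"
    using invP PQd qQ pos r unfolding Q_def[symmetric] by (intro add_mono mult_mono) auto
  also have "\<dots> = \<bar>p - q\<bar> * (2 / r + 32 / r * (1 / r * (1 / r)))" by (simp add: field_simps)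
  also have "\<dots> \<le> \<bar>p - q\<bar> * (3 / r)"
  proof (intro mult_left_mono)
    have "1 / r * (1 / r) \<le> 1/100 * (1/100)" using r by (intro mult_mono) (auto simp: field_simps)
    then have "32 / r * (1 / r * (1 / r)) \<le> 32 / r * (1/100 * (1/100))" using r by (intro mult_left_mono) auto
    also have "\<dots> \<le> 1 / r" using r by (simp add: field_simps)
    finally show "2 / r + 32 / r * (1 / r * (1 / r)) \<le> 3 / r" by (simp add: add_divide_distrib[symmetric])
  qed simp
  finally show "\<bar>p / sqrt (r\<^sup>2 - p\<^sup>2) - q / sqrt (r\<^sup>2 - q\<^sup>2)\<bar> \<le> 3 / r * \<bar>p - q\<bar>"
    unfolding P_def Q_def by (simp add: mult.commute)
qed

lemma abs_Re_Im_cis_le: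
  "\<bar>Re (cis \<theta> * z)\<bar> \<le> norm z" "\<bar>Im (cis \<theta> * z)\<bar> \<le> norm z"
  using abs_Re_le_cmod[of "cis \<theta> * z"] abs_Im_le_cmod[of "cis \<theta> * z"] by (simp_all add: norm_mult)

text \<open>The circular corrections at the two points differ by at most \<open>4 / r\<close> times
  the difference of the orthogonal coordinates.\<close>

lemma circ_proj_diff:
  assumes r: "r \<ge> 100" and a: "norm a \<le> 2" and b: "norm b \<le> 2"
  shows "\<bar>circ_proj r \<theta> a - circ_proj r \<theta> b - Re (cis (- \<theta>) * (a - b))\<bar> \<le> 4 / r * norm (a - b)"
proof -
  define p q where "p = Im (cis (- \<theta>) * a)" and "q = Im (cis (- \<theta>) * b)"
  have "\<bar>p\<bar> \<le> 2" "\<bar>q\<bar> \<le> 2"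
    using abs_Re_Im_cis_le(2)[of "- \<theta>"] a b unfolding p_def q_def by (metis order_trans)+
  then have "\<bar>sqrt (r\<^sup>2 - p\<^sup>2) - sqrt (r\<^sup>2 - q\<^sup>2)\<bar> \<le> 4 / r * \<bar>p - q\<bar>"
    by (rule sqrt_circle_lipschitz[OF r])
  also have "p - q = Im (cis (- \<theta>) * (a - b))" unfolding p_def q_def by (simp add: algebra_simps)
  also have "4 / r * \<bar>\<dots>\<bar> \<le> 4 / r * norm (a - b)"
    using r by (intro mult_left_mono abs_Re_Im_cis_le) auto
  finally have "\<bar>sqrt (r\<^sup>2 - p\<^sup>2) - sqrt (r\<^sup>2 - q\<^sup>2)\<bar> \<le> 4 / r * norm (a - b)" .
  moreover have "circ_proj r \<theta> a - circ_proj r \<theta> b - Re (cis (- \<theta>) * (a - b))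
      = sqrt (r\<^sup>2 - p\<^sup>2) - sqrt (r\<^sup>2 - q\<^sup>2)"
    unfolding circ_proj_eq[OF a] circ_proj_eq[OF b] p_def[symmetric] q_def[symmetric]
    by (simp add: algebra_simps)
  ultimately show ?thesis by simp
qed

section \<open>Transversality in the angle\<close>

definition circ_slope :: "real \<Rightarrow> real \<Rightarrow> complex \<Rightarrow> real" where
  "circ_slope r \<theta> z = (let w = cis (- \<theta>) * z in Im w + Im w / sqrt (r\<^sup>2 - (Im w)\<^sup>2) * Re w)"

text \<open>The rotated point \<open>w = cis (- \<theta>) * z\<close> satisfies
  \<open>w' = - \<i> * w\<close>, so \<open>Re w\<close> has derivative \<open>Im w\<close> and
  \<open>Im w\<close> has derivative \<open>- Re w\<close>. The second summand of
  \<open>circ_slope\<close> comes from the square root.\<close>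

lemma circ_proj_has_derivative:
  assumes r: "r \<ge> 100" and z: "norm z \<le> 2"
  shows "((\<lambda>\<theta>. circ_proj r \<theta> z) has_real_derivative circ_slope r \<theta> z) (at \<theta>)"
proof -
  define y where "y = Im (cis (- \<theta>) * z)"
  have "\<bar>y\<bar> \<le> 2" using abs_Re_Im_cis_le(2)[of "- \<theta>" z] z unfolding y_def by linarith
  then have pos: "r\<^sup>2 - y\<^sup>2 > 0" using sqrt_ge_half[OF r] by auto
  have 1: "((\<lambda>\<theta>. Re (cis (- \<theta>) * z)) has_real_derivative Im (cis (- \<theta>) * z)) (at \<theta>)"
    by (auto intro!: derivative_eq_intros)
  have 2: "((\<lambda>\<theta>. Im (cis (- \<theta>) * z)) has_real_derivative - Re (cis (- \<theta>) * z)) (at \<theta>)"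
    by (auto intro!: derivative_eq_intros)
  have 3: "((\<lambda>\<theta>. sqrt (r\<^sup>2 - (Im (cis (- \<theta>) * z))\<^sup>2)) has_real_derivative
      y / sqrt (r\<^sup>2 - y\<^sup>2) * Re (cis (- \<theta>) * z)) (at \<theta>)"
  proof -
    have "((\<lambda>\<theta>. sqrt (r\<^sup>2 - (g \<theta>)\<^sup>2)) has_real_derivative g \<theta> / sqrt (r\<^sup>2 - (g \<theta>)\<^sup>2) * g') (at \<theta>)"
      if "(g has_real_derivative - g') (at \<theta>)" "r\<^sup>2 - (g \<theta>)\<^sup>2 > 0" for g g'
      using that by (auto intro!: derivative_eq_intros simp: field_simps)
    from this[OF 2] pos show ?thesis unfolding y_def by blast
  qed
  have "((\<lambda>\<theta>. Re (cis (- \<theta>) * z) - r + sqrt (r\<^sup>2 - (Im (cis (- \<theta>) * z))\<^sup>2)) has_real_derivative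
     Im (cis (- \<theta>) * z) - 0 + y / sqrt (r\<^sup>2 - y\<^sup>2) * Re (cis (- \<theta>) * z)) (at \<theta>)"
    by (intro DERIV_add DERIV_diff 1 3 DERIV_const)
  then show ?thesis
    by (simp only: circ_slope_def Let_def circ_proj_eq[OF z] y_def diff_zero)
qed

text \<open>The linear part supplies the imaginary part exactly. The curvature part changes by at
  most \<open>(3 * 2 + 4) / r\<close> times the distance, by the two bounds of
  \<open>circle_slope_lipschitz\<close>.\<close>

lemma circ_slope_diff_ge:
  assumes r: "r \<ge> 100" and a: "norm a \<le> 2" and b: "norm b \<le> 2"
  shows "\<bar>circ_slope r \<theta> a - circ_slope r \<theta> b\<bar> \<ge> \<bar>Im (cis (- \<theta>) * (a - b))\<bar> - norm (a - b) / 10"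
proof -
  define u v where "u = cis (- \<theta>) * a" and "v = cis (- \<theta>) * b"
  define S where "S = (\<lambda>w. Im w / sqrt (r\<^sup>2 - (Im w)\<^sup>2))"
  have uv: "u - v = cis (- \<theta>) * (a - b)" by (simp add: u_def v_def algebra_simps)
  have nuv: "norm (u - v) = norm (a - b)" unfolding uv by (simp add: norm_mult)
  have uv2: "\<bar>Re u\<bar> \<le> 2" "\<bar>Im u\<bar> \<le> 2" "\<bar>Im v\<bar> \<le> 2"
    using abs_Re_Im_cis_le[of "- \<theta>"] a b unfolding u_def v_def by (metis order_trans)+
  have d: "\<bar>Re u - Re v\<bar> \<le> norm (a - b)" "\<bar>Im u - Im v\<bar> \<le> norm (a - b)"
    using abs_Re_le_cmod[of "u - v"] abs_Im_le_cmod[of "u - v"] unfolding nuv by simp_all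
  have "S u * Re u - S v * Re v = (S u - S v) * Re u + S v * (Re u - Re v)" by (simp add: algebra_simps)
  then have "\<bar>S u * Re u - S v * Re v\<bar> \<le> \<bar>S u - S v\<bar> * \<bar>Re u\<bar> + \<bar>S v\<bar> * \<bar>Re u - Re v\<bar>"
    by (metis abs_mult abs_triangle_ineq)
  also have "\<dots> \<le> (3 / r * \<bar>Im u - Im v\<bar>) * 2 + 4 / r * \<bar>Re u - Re v\<bar>"
    unfolding S_def using circle_slope_lipschitz[OF r uv2(2,3)] uv2 r
    by (intro add_mono mult_mono) auto
  also have "\<dots> \<le> (3 / r * norm (a - b)) * 2 + 4 / r * norm (a - b)"
    using d r by (intro add_mono mult_mono) auto
  also have "\<dots> = 10 / r * norm (a - b)" by (simp add: field_simps)
  also have "\<dots> \<le> 1 / 10 * norm (a - b)" using r by (intro mult_right_mono) (auto simp: field_simps)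
  finally have "\<bar>S u * Re u - S v * Re v\<bar> \<le> norm (a - b) / 10" by simp
  moreover have "circ_slope r \<theta> a - circ_slope r \<theta> b = Im (u - v) + (S u * Re u - S v * Re v)"
    by (simp add: circ_slope_def Let_def u_def v_def S_def)
  ultimately show ?thesis unfolding uv by linarith
qed

lemma norm_cis_diff_le: "norm (cis s - cis t) \<le> \<bar>s - t\<bar>"
proof -
  have "cis s - cis t = cis t * (cis (s - t) - 1)" by (simp add: algebra_simps cis_mult)
  then have "norm (cis s - cis t) = norm (exp (\<i> * of_real (s - t)) - 1)"
    by (simp add: norm_mult cis_conv_exp)
  also have "\<dots> = 2 * \<bar>sin ((s - t) / 2)\<bar>" by (rule dist_exp_i_1)
  also have "\<dots> \<le> 2 * \<bar>(s - t) / 2\<bar>" by (intro mult_left_mono abs_sin_x_le_abs_x) simp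
  finally show ?thesis by simp
qed

lemma Re_cis_mult_diff_le:
  "\<bar>Re (cis (- s) * d) - Re (cis (- t) * d)\<bar> \<le> \<bar>s - t\<bar> * norm d"
proof -
  have "\<bar>Re ((cis (- s) - cis (- t)) * d)\<bar> \<le> norm (cis (- s) - cis (- t)) * norm d"
    using abs_Re_le_cmod[of "(cis (- s) - cis (- t)) * d"] by (simp only: norm_mult)
  also have "\<dots> \<le> \<bar>- s - - t\<bar> * norm d" by (intro mult_right_mono norm_cis_diff_le) simp
  finally show ?thesis by (simp add: algebra_simps abs_minus_commute)
qed

text \<open>When the curved projections nearly agree, the rotated difference vector has a small real
  part and hence a large imaginary one, so their difference changes with the angle at a rate of at
  least a quarter of the distance. The mean value theorem then keeps two such angles close.\<close>

lemma circ_proj_transversal: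
  assumes r: "r \<ge> 100" and a: "norm a \<le> 2" and b: "norm b \<le> 2"
    and d: "\<delta> \<le> norm (a - b) / 8"
    and I: "\<And>s t. s \<in> I \<Longrightarrow> t \<in> I \<Longrightarrow> \<bar>s - t\<bar> \<le> 1/4" "is_interval I"
    and s: "s \<in> I" "\<bar>circ_proj r s a - circ_proj r s b\<bar> \<le> \<delta>"
    and t: "t \<in> I" "\<bar>circ_proj r t a - circ_proj r t b\<bar> \<le> \<delta>"
  shows "\<bar>s - t\<bar> * norm (a - b) \<le> 8 * \<delta>"
proof -
  define D where "D = norm (a - b)"
  define h where "h = (\<lambda>\<theta>. circ_proj r \<theta> a - circ_proj r \<theta> b)"
  have *: "\<bar>s - t\<bar> * D \<le> 8 * \<delta>" if st: "s < t" "s \<in> I" "t \<in> I" "\<bar>h s\<bar> \<le> \<delta>" "\<bar>h t\<bar> \<le> \<delta>" for s t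
  proof -
    have "(h has_real_derivative circ_slope r \<theta> a - circ_slope r \<theta> b) (at \<theta>)" for \<theta>
      unfolding h_def by (intro DERIV_diff circ_proj_has_derivative r a b)
    then obtain z where z: "s < z" "z < t" "h t - h s = (t - s) * (circ_slope r z a - circ_slope r z b)"
      using MVT2[OF st(1), of h "\<lambda>\<theta>. circ_slope r \<theta> a - circ_slope r \<theta> b"] by auto
    have "z \<in> I" using I(2) st(2,3) z by (meson is_interval_1 less_imp_le)
    then have "\<bar>z - s\<bar> \<le> 1/4" using I(1) st(2) by blast
    then have "\<bar>z - s\<bar> * D \<le> 1/4 * D" unfolding D_def by (intro mult_right_mono) auto
    then have "\<bar>Re (cis (- z) * (a - b)) - Re (cis (- s) * (a - b))\<bar> \<le> D / 4"
      using Re_cis_mult_diff_le[of z "a - b" s] unfolding D_def by linarith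
    moreover have "\<bar>h s - Re (cis (- s) * (a - b))\<bar> \<le> 4 / r * D"
      unfolding h_def D_def by (rule circ_proj_diff[OF r a b])
    moreover have "4 / r * D \<le> 1/25 * D"
      using r unfolding D_def by (intro mult_right_mono) (auto simp: field_simps)
    moreover have "\<bar>h s\<bar> \<le> D / 8" using st(4) d unfolding D_def by linarith
    \<comment> \<open>The contributions are \<open>D / 4\<close> from the rotation,
      \<open>D / 25\<close> from the curvature and \<open>D / 8\<close> from \<open>h s\<close>. The
      slope is then at least \<open>D / 2 - D / 10\<close>.\<close>
    ultimately have x: "\<bar>Re (cis (- z) * (a - b))\<bar> \<le> D / 2" by linarith
    have "D \<le> \<bar>Re (cis (- z) * (a - b))\<bar> + \<bar>Im (cis (- z) * (a - b))\<bar>"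
      using cmod_le[of "cis (- z) * (a - b)"] by (simp only: D_def norm_mult norm_cis mult_1)
    then have "\<bar>circ_slope r z a - circ_slope r z b\<bar> \<ge> D / 4"
      using x circ_slope_diff_ge[OF r a b, of z] norm_ge_zero[of "a - b"] unfolding D_def by linarith
    then have "\<bar>t - s\<bar> * (D / 4) \<le> \<bar>h t - h s\<bar>"
      unfolding z(3) abs_mult by (intro mult_left_mono) auto
    then have "\<bar>s - t\<bar> * D \<le> 4 * \<bar>h t - h s\<bar>" by (simp add: abs_minus_commute)
    also have "\<bar>h t - h s\<bar> \<le> 2 * \<delta>" using st(4,5) by linarith
    finally show ?thesis by simp
  qed
  consider "s < t" | "t < s" | "s = t" by linarith
  then show ?thesis
  proof cases
    case 1
    then show ?thesis using *[of s t] s t unfolding D_def h_def by simp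
  next
    case 2
    then show ?thesis using *[of t s] s t unfolding D_def h_def by (simp add: abs_minus_commute)
  next
    case 3
    then show ?thesis using s by simp
  qed
qed

subsection \<open>The second moment\<close>

text \<open>With \<open>f\<close> the number of intervals covering a point, this integrates \<open>2 f / L - f\<^sup>2 / L\<^sup>2 \<le> 1\<close>,
  a linearised form of the Cauchy--Schwarz bound for the measure of the support of \<open>f\<close>.\<close>
lemma measure_UN_intervals_ge:
  fixes c :: "'a \<Rightarrow> real"
  assumes A: "finite A" and \<delta>: "\<delta> \<ge> 0" and L: "L > 0"
  shows "measure lebesgue (\<Union>a\<in>A. {c a..c a + \<delta>})
    \<ge> 2 / L * (\<delta> * card A) - 1 / L\<^sup>2 * (\<delta> * (\<Sum>(a, b)\<in>A \<times> A. of_bool (\<bar>c a - c b\<bar> \<le> \<delta>)))"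
proof -
  define I where "I = (\<lambda>a. {c a..c a + \<delta>})"
  define f where "f = (\<lambda>x. \<Sum>a\<in>A. indicator (I a) x :: real)"
  have I: "I a \<in> lmeasurable" for a unfolding I_def by simp
  have Un: "(\<Union>a\<in>A. I a) \<in> lmeasurable" using A I by (auto intro: fmeasurable.finite_UN)
  have int_I: "integrable lebesgue (indicat_real S)" if "S \<in> lmeasurable" for S
    using that by (intro integrable_real_indicator) (auto simp: fmeasurable_def)
  have ff: "f x * f x = (\<Sum>(a, b)\<in>A \<times> A. indicat_real (I a \<inter> I b) x)" for x
    unfolding f_def sum_product sum.cartesian_product by (simp add: indicator_inter_arith)
  have pw: "2 / L * f x - 1 / L\<^sup>2 * (\<Sum>(a, b)\<in>A \<times> A. indicat_real (I a \<inter> I b) x)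
      \<le> indicator (\<Union>a\<in>A. I a) x" for x
  proof (cases "x \<in> (\<Union>a\<in>A. I a)")
    case True
    have "0 \<le> (1 - f x / L)\<^sup>2" by simp
    also have "\<dots> = 1 - (2 / L * f x - 1 / L\<^sup>2 * (f x * f x))"
      using L by (simp add: power2_diff power_divide power2_eq_square field_simps)
    finally show ?thesis using True unfolding ff[symmetric] by simp
  next
    case False
    then have "f x = 0" unfolding f_def by (auto intro!: sum.neutral simp: indicator_def)
    then show ?thesis unfolding ff[symmetric] using False by simp
  qed
  have i1: "integrable lebesgue f" unfolding f_def using int_I I by (intro Bochner_Integration.integrable_sum) auto
  have i2: "integrable lebesgue (\<lambda>x. \<Sum>(a, b)\<in>A \<times> A. indicat_real (I a \<inter> I b) x)"
    using int_I I by (auto intro!: Bochner_Integration.integrable_sum split: prod.split)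
  have "(\<integral>x. 2 / L * f x - 1 / L\<^sup>2 * (\<Sum>(a, b)\<in>A \<times> A. indicat_real (I a \<inter> I b) x) \<partial>lebesgue)
      \<le> (\<integral>x. indicator (\<Union>a\<in>A. I a) x \<partial>lebesgue)"
    using i1 i2 Un pw by (intro integral_mono int_I) auto
  also have "\<dots> = measure lebesgue (\<Union>a\<in>A. I a)" by simp
  also have "(\<integral>x. 2 / L * f x - 1 / L\<^sup>2 * (\<Sum>(a, b)\<in>A \<times> A. indicat_real (I a \<inter> I b) x) \<partial>lebesgue)
      = 2 / L * (\<integral>x. f x \<partial>lebesgue)
        - 1 / L\<^sup>2 * (\<integral>x. (\<Sum>(a, b)\<in>A \<times> A. indicat_real (I a \<inter> I b) x) \<partial>lebesgue)"
    using i1 i2 by simp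
  also have "(\<integral>x. f x \<partial>lebesgue) = (\<Sum>a\<in>A. measure lebesgue (I a))"
    unfolding f_def using int_I[OF I] by (subst Bochner_Integration.integral_sum) auto
  also have "\<dots> = \<delta> * card A" using \<delta> by (simp add: I_def)
  also have "(\<integral>x. (\<Sum>(a, b)\<in>A \<times> A. indicat_real (I a \<inter> I b) x) \<partial>lebesgue)
      = (\<Sum>(a, b)\<in>A \<times> A. measure lebesgue (I a \<inter> I b))"
    using int_I I by (subst Bochner_Integration.integral_sum) (auto intro!: sum.cong split: prod.split)
  finally have 1: "2 / L * (\<delta> * card A) - 1 / L\<^sup>2 * (\<Sum>(a, b)\<in>A \<times> A. measure lebesgue (I a \<inter> I b))
      \<le> measure lebesgue (\<Union>a\<in>A. I a)" .
  have "measure lebesgue (I a \<inter> I b) \<le> \<delta> * of_bool (\<bar>c a - c b\<bar> \<le> \<delta>)" for a b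
  proof (cases "\<bar>c a - c b\<bar> \<le> \<delta>")
    case True
    have "measure lebesgue (I a \<inter> I b) \<le> measure lebesgue (I a)"
      using I by (intro measure_mono_fmeasurable) (auto simp: fmeasurableD)
    then show ?thesis using True \<delta> by (simp add: I_def)
  next
    case False
    then have "I a \<inter> I b = {}" unfolding I_def by auto
    then show ?thesis using False by simp
  qed
  then have "(\<Sum>(a, b)\<in>A \<times> A. measure lebesgue (I a \<inter> I b))
      \<le> \<delta> * (\<Sum>(a, b)\<in>A \<times> A. of_bool (\<bar>c a - c b\<bar> \<le> \<delta>))"
    unfolding sum_distrib_left by (intro sum_mono) auto
  then have "1 / L\<^sup>2 * (\<Sum>(a, b)\<in>A \<times> A. measure lebesgue (I a \<inter> I b))
      \<le> 1 / L\<^sup>2 * (\<delta> * (\<Sum>(a, b)\<in>A \<times> A. of_bool (\<bar>c a - c b\<bar> \<le> \<delta>)))"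
    by (intro mult_left_mono) auto
  then show ?thesis using 1 unfolding I_def by linarith
qed

section \<open>Measurability and integration in the angle\<close>

lemma continuous_on_circ_proj:
  assumes "continuous_on S \<theta>" "continuous_on S z"
  shows "continuous_on S (\<lambda>x. circ_proj r (\<theta> x) (z x))"
proof -
  \<comment> \<open>Capping \<open>y\<^sup>2\<close> at 4 merges the two branches into one formula,
    continuous for every \<open>r\<close> because the real \<open>sqrt\<close> is continuous on the
    whole line.\<close>
  have "f_r r y = r - sqrt (r\<^sup>2 - min (y\<^sup>2) 4)" for y
    using abs_le_square_iff[of y 2] by (auto simp: f_r_def min_def)
  then show ?thesis
    unfolding circ_proj_def using assms
    by (simp only:) (intro continuous_intros)
qed

text \<open>The images are the vertical sections of a compact set \<open>\<Gamma>\<close> in the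
  plane, so their lengths depend measurably on the angle; boundedness of \<open>\<Gamma>\<close>
  gives a constant majorant.\<close>

lemma measure_circ_proj_integrable_on:
  assumes K: "compact K"
  shows "(\<lambda>\<theta>. measure lebesgue (circ_proj r \<theta> ` K)) integrable_on {u..v}"
proof -
  define \<Gamma> where "\<Gamma> = (\<lambda>(\<theta>, z). (\<theta>, circ_proj r \<theta> z)) ` ({u..v} \<times> K)"
  have "compact \<Gamma>" unfolding \<Gamma>_def case_prod_beta
    using K by (intro compact_continuous_image compact_Times continuous_on_Pair continuous_on_circ_proj
        continuous_intros) auto
  then have "\<Gamma> \<in> sets (borel :: (real \<times> real) measure)" by (intro borel_compact)
  then have "\<Gamma> \<in> sets (lborel \<Otimes>\<^sub>M lborel)" by (simp only: lborel_prod sets_lborel)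
  then have "(\<lambda>\<theta>. emeasure lborel (Pair \<theta> -` \<Gamma>)) \<in> borel_measurable lborel"
    by (rule lborel.measurable_emeasure_Pair)
  then have m: "(\<lambda>\<theta>. measure lborel (Pair \<theta> -` \<Gamma>)) \<in> borel_measurable lborel"
    unfolding measure_def by measurable
  have eq: "measure lborel (Pair \<theta> -` \<Gamma>) = measure lebesgue (circ_proj r \<theta> ` K)" if "\<theta> \<in> {u..v}" for \<theta>
  proof -
    have "Pair \<theta> -` \<Gamma> = circ_proj r \<theta> ` K" using that unfolding \<Gamma>_def by force
    moreover have "compact (circ_proj r \<theta> ` K)"
      using K by (intro compact_continuous_image continuous_on_circ_proj continuous_intros) auto
    ultimately show ?thesis by (simp add: measure_completion borel_compact)
  qed
  have "bounded (snd ` \<Gamma>)" using \<open>compact \<Gamma>\<close>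
    by (intro compact_imp_bounded compact_continuous_image continuous_intros)
  then obtain B where B: "\<And>x. x \<in> snd ` \<Gamma> \<Longrightarrow> \<bar>x\<bar> \<le> B" unfolding bounded_iff by auto
  have bd: "norm (measure lborel (Pair \<theta> -` \<Gamma>)) \<le> measure lborel {-B..B}" for \<theta>
  proof -
    have "Pair \<theta> -` \<Gamma> \<in> sets borel" using \<open>\<Gamma> \<in> sets (lborel \<Otimes>\<^sub>M lborel)\<close>
      by (metis sets_Pair1 sets_lborel)
    moreover have "Pair \<theta> -` \<Gamma> \<subseteq> {-B..B}" using B by (force simp: abs_le_iff)
    ultimately have "measure lborel (Pair \<theta> -` \<Gamma>) \<le> measure lborel {-B..B}"
      using emeasure_compact_finite[of "{-B..B}"]
      by (intro measure_mono_fmeasurable) (auto simp: fmeasurable_def)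
    then show ?thesis by simp
  qed
  have "(\<lambda>\<theta>. measure lborel (Pair \<theta> -` \<Gamma>)) integrable_on {u..v}"
  proof (rule measurable_bounded_by_integrable_imp_integrable)
    show "(\<lambda>\<theta>. measure lborel (Pair \<theta> -` \<Gamma>)) \<in> borel_measurable (lebesgue_on {u..v})"
      using m by (intro measurable_restrict_space1 measurable_completion) simp
    show "(\<lambda>\<theta>. measure lborel {-B..B}) integrable_on {u..v}" by (rule integrable_const_ivl)
  qed (use bd in auto)
  then show ?thesis by (rule integrable_eq) (use eq in auto)
qed

lemma finite_cantor_left: "finite (cantor_left n)"
  by (induction n) auto

lemma compact_K_stage: "compact (K_stage n)"
proof -
  have "compact (cantor_stage n)"
    unfolding cantor_stage_def by (intro compact_UN finite_cantor_left) auto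
  then have "compact ((\<lambda>(x, y). Complex x y) ` (cantor_stage n \<times> cantor_stage n))"
    unfolding case_prod_beta Complex_eq by (intro compact_continuous_image compact_Times continuous_intros)
  also have "(\<lambda>(x, y). Complex x y) ` (cantor_stage n \<times> cantor_stage n) = K_stage n"
    unfolding K_stage_def by (auto simp: image_iff complex_eq_iff)
  finally show ?thesis .
qed

lemma corner_ray_mem_K_stage:
  assumes m: "m < 4 ^ n" and \<theta>: "\<theta> \<in> {0..pi / 2}" and t: "t \<in> {0..1 / 4 ^ n}"
  shows "corner n m + of_real t * cis \<theta> \<in> K_stage n"
proof -
  have "0 \<le> t * cos \<theta>" "t * cos \<theta> \<le> t * 1" "0 \<le> t * sin \<theta>" "t * sin \<theta> \<le> t * 1"
    using \<theta> t by (auto intro!: mult_nonneg_nonneg mult_left_le cos_ge_zero sin_ge_zero)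
  moreover have "real (spread b m) / 4 ^ n + x \<in> cantor_stage n"
    if "bit_selector b" "0 \<le> x" "x \<le> t" for b x
    unfolding cantor_stage_def using that t
    by (intro UN_I[OF spread_mem_cantor_left[OF that(1) m]]) (auto simp: power_one_over)
  ultimately show ?thesis
    using bit_selector_div2 bit_selector_mod2 by (simp add: K_stage_def corner_def)
qed

text \<open>Each square contains a segment in direction \<open>e\<^sup>i\<^sup>\<theta>\<close> issued from its lower left corner, and on it
  the curved projection is a translation: the perturbation only depends on the orthogonal coordinate.\<close>
lemma UN_intervals_subset_circ_proj:
  assumes "\<theta> \<in> {0..pi / 2}"
  shows "(\<Union>m<4 ^ n. {circ_proj r \<theta> (corner n m)..circ_proj r \<theta> (corner n m) + 1 / 4 ^ n})
    \<subseteq> circ_proj r \<theta> ` K_stage n"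
proof (rule subsetI, elim UN_E)
  fix x m assume m: "m \<in> {..<4 ^ n :: nat}"
    and x: "x \<in> {circ_proj r \<theta> (corner n m)..circ_proj r \<theta> (corner n m) + 1 / 4 ^ n}"
  define t where "t = x - circ_proj r \<theta> (corner n m)"
  have "corner n m + of_real t * cis \<theta> \<in> K_stage n"
    using m x assms by (intro corner_ray_mem_K_stage) (auto simp: t_def)
  moreover have "circ_proj r \<theta> (corner n m + of_real t * cis \<theta>) = x"
    unfolding circ_proj_add_ray by (simp add: t_def)
  ultimately show "x \<in> circ_proj r \<theta> ` K_stage n" by blast
qed

lemma measure_circ_proj_ge:
  assumes "\<theta> \<in> {0..pi / 2}"
  shows "measure lebesgue (circ_proj r \<theta> ` K_stage n)
    \<ge> measure lebesgue (\<Union>m<4 ^ n. {circ_proj r \<theta> (corner n m)..circ_proj r \<theta> (corner n m) + 1 / 4 ^ n})"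
proof (rule measure_mono_fmeasurable[OF UN_intervals_subset_circ_proj[OF assms]])
  show "circ_proj r \<theta> ` K_stage n \<in> lmeasurable"
    by (intro lmeasurable_compact compact_continuous_image continuous_on_circ_proj continuous_intros compact_K_stage)
qed auto

text \<open>The condition says that the intervals of length \<open>1 / 4 ^ n\<close> starting at the
  two projected corners meet.\<close>

definition overlap_angles :: "real \<Rightarrow> nat \<Rightarrow> nat \<Rightarrow> nat \<Rightarrow> real set" where
  "overlap_angles r n m m' =
    {\<theta>. \<bar>circ_proj r \<theta> (corner n m) - circ_proj r \<theta> (corner n m')\<bar> \<le> 1 / 4 ^ n}"

lemma closed_overlap_angles: "closed (overlap_angles r n m m')"
  unfolding overlap_angles_def
  by (intro closed_Collect_le continuous_intros continuous_on_circ_proj)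

text \<open>This integrates \<open>measure_UN_intervals_ge\<close> over the angle. The
  \<open>4 ^ n\<close> intervals have total length 1, whence the linear term; \<open>L\<close> stays
  free for later optimisation.\<close>

lemma integral_measure_circ_proj_ge:
  assumes u: "0 \<le> u" "u \<le> v" "v \<le> pi / 2" and L: "L > 0"
  shows "integral {u..v} (\<lambda>\<theta>. measure lebesgue (circ_proj r \<theta> ` K_stage n))
    \<ge> 2 / L * (v - u) - 1 / L\<^sup>2 * (1 / 4 ^ n *
      (\<Sum>(m, m')\<in>{..<4 ^ n} \<times> {..<4 ^ n}. measure lebesgue (overlap_angles r n m m' \<inter> {u..v})))"
proof -
  let ?A = "{..<4 ^ n} \<times> {..<4 ^ n :: nat}"
  define h where "h = (\<lambda>\<theta>. 2 / L - 1 / L\<^sup>2 * (1 / 4 ^ n *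
    (\<Sum>(m, m')\<in>?A. indicat_real (overlap_angles r n m m') \<theta>)))"
  have I: "(indicat_real (overlap_angles r n m m') has_integral
      measure lebesgue (overlap_angles r n m m' \<inter> {u..v})) {u..v}" for m m'
  proof -
    have "overlap_angles r n m m' \<inter> {u..v} \<in> lmeasurable"
      by (intro lmeasurable_compact closed_Int_compact closed_overlap_angles compact_Icc)
    then show ?thesis by (simp add: has_integral_iff integral_indicator integrable_on_indicator)
  qed
  have "(h has_integral (v - u) *\<^sub>R (2 / L) - 1 / L\<^sup>2 * (1 / 4 ^ n *
      (\<Sum>p\<in>?A. measure lebesgue (overlap_angles r n (fst p) (snd p) \<inter> {u..v})))) {u..v}"
    unfolding h_def case_prod_beta using u(2)
    by (intro has_integral_diff has_integral_const_real[THEN has_integral_eq_rhs]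
        has_integral_mult_right has_integral_sum I) auto
  then have "2 / L * (v - u) - 1 / L\<^sup>2 * (1 / 4 ^ n *
      (\<Sum>(m, m')\<in>?A. measure lebesgue (overlap_angles r n m m' \<inter> {u..v}))) = integral {u..v} h"
    and hi: "h integrable_on {u..v}"
    by (auto simp: has_integral_iff case_prod_beta mult.commute)
  note this(1)
  also have "integral {u..v} h \<le> integral {u..v} (\<lambda>\<theta>. measure lebesgue (circ_proj r \<theta> ` K_stage n))"
  proof (rule integral_le[OF hi measure_circ_proj_integrable_on[OF compact_K_stage]])
    fix \<theta> assume "\<theta> \<in> {u..v}"
    then have \<theta>: "\<theta> \<in> {0..pi / 2}" using u by auto
    have "h \<theta> = 2 / L * (1 / 4 ^ n * card {..<4 ^ n :: nat}) - 1 / L\<^sup>2 * (1 / 4 ^ n *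
        (\<Sum>(m, m')\<in>?A. of_bool (\<bar>circ_proj r \<theta> (corner n m) - circ_proj r \<theta> (corner n m')\<bar> \<le> 1 / 4 ^ n)))"
      by (simp add: h_def overlap_angles_def indicator_def)
    also have "\<dots> \<le> measure lebesgue
        (\<Union>m<4 ^ n. {circ_proj r \<theta> (corner n m)..circ_proj r \<theta> (corner n m) + 1 / 4 ^ n})"
      by (rule measure_UN_intervals_ge) (use L in auto)
    also have "\<dots> \<le> measure lebesgue (circ_proj r \<theta> ` K_stage n)" by (rule measure_circ_proj_ge[OF \<theta>])
    finally show "h \<theta> \<le> measure lebesgue (circ_proj r \<theta> ` K_stage n)" .
  qed
  finally show ?thesis .
qed

subsection \<open>Counting overlaps near the tiling direction\<close>

text \<open>The direction is \<open>(2, 1) / sqrt 5\<close>, so \<open>spread_sum\<close> applies.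
  The spacing of consecutive corners is exactly the length of the projection of one square.\<close>

lemma Re_corner_diff_arctan_half:
  "Re (cis (- arctan (1/2)) * (corner n m - corner n m')) = 3 / sqrt 5 * (real m - real m') / 4 ^ n"
proof -
  have s: "sqrt (1 + (1/2)\<^sup>2) = sqrt 5 / 2"
    by (simp add: real_sqrt_divide power_divide)
  have c: "cos (arctan (1/2)) = 2 / sqrt 5" "sin (arctan (1/2)) = 1 / sqrt 5"
    unfolding cos_arctan sin_arctan s by simp_all
  have "2 * real (spread (\<lambda>q. q div 2) m) + real (spread (\<lambda>q. q mod 2) m) = 3 * real m" for m
    using arg_cong[OF spread_sum[of m], of real] by simp
  from this[of m] this[of m'] show ?thesis
    unfolding corner_def by (simp add: c field_simps)
qed

text \<open>Relative to the exact value at \<open>arctan (1/2)\<close>, turning costs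
  \<open>1 / 4 ^ k\<close> and curvature \<open>16 / 4 ^ k\<close> times the distance of the
  corners, which is at most \<open>8 * 4 ^ i / 4 ^ n\<close>; hence
  \<open>136 = 17 * 8\<close>.\<close>

lemma overlap_angles_index_close:
  assumes r: "r \<ge> 100" "4 / r \<le> 16 / 4 ^ k" and m: "m < 4 ^ n" "m' < 4 ^ n" and s: "split_at i m m'"
    and \<theta>: "\<theta> \<in> overlap_angles r n m m'" "\<theta> \<in> {arctan (1/2)..arctan (1/2) + 1 / 4 ^ k}"
  shows "\<bar>real m - real m'\<bar> \<le> 1 + 136 * (4 ^ i / 4 ^ k)"
proof -
  define d where "d = corner n m - corner n m'"
  define \<theta>0 :: real where "\<theta>0 = arctan (1/2)"
  have "\<bar>\<theta> - \<theta>0\<bar> * norm d \<le> 1 / 4 ^ k * norm d"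
    using \<theta>(2) unfolding \<theta>0_def by (intro mult_right_mono) auto
  then have 1: "\<bar>Re (cis (- \<theta>) * d) - Re (cis (- \<theta>0) * d)\<bar> \<le> 1 / 4 ^ k * norm d"
    using Re_cis_mult_diff_le[of \<theta> d \<theta>0] by linarith
  have "4 / r * norm d \<le> 16 / 4 ^ k * norm d" using r(2) by (intro mult_right_mono) auto
  then have 2: "\<bar>circ_proj r \<theta> (corner n m) - circ_proj r \<theta> (corner n m') - Re (cis (- \<theta>) * d)\<bar>
      \<le> 16 / 4 ^ k * norm d"
    using circ_proj_diff[OF r(1) corner_norm_le[OF m(1)] corner_norm_le[OF m(2)], of \<theta>]
    unfolding d_def by linarith
  have 3: "\<bar>circ_proj r \<theta> (corner n m) - circ_proj r \<theta> (corner n m')\<bar> \<le> 1 / 4 ^ n"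
    using \<theta>(1) by (simp add: overlap_angles_def)
  have "sqrt 5 \<le> 3" by (rule real_le_lsqrt) auto
  then have "\<bar>real m - real m'\<bar> * 1 \<le> \<bar>real m - real m'\<bar> * (3 / sqrt 5)"
    by (intro mult_left_mono) auto
  then have "\<bar>real m - real m'\<bar> / 4 ^ n \<le> \<bar>real m - real m'\<bar> * (3 / sqrt 5) / 4 ^ n"
    by (intro divide_right_mono) auto
  also have "\<dots> = \<bar>3 / sqrt 5 * (real m - real m') / 4 ^ n\<bar>"
    unfolding abs_mult abs_divide by simp
  also have "\<dots> = \<bar>Re (cis (- \<theta>0) * d)\<bar>"
    unfolding d_def \<theta>0_def Re_corner_diff_arctan_half ..
  also have "\<dots> \<le> 1 / 4 ^ n + (1 / 4 ^ k * norm d + 16 / 4 ^ k * norm d)" using 1 2 3 by linarith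
  also have "1 / 4 ^ k * norm d + 16 / 4 ^ k * norm d = 17 / 4 ^ k * norm d"
    by (simp add: field_simps)
  also have "17 / 4 ^ k * norm d \<le> 17 / 4 ^ k * (8 * 4 ^ i / 4 ^ n)"
    using corner_diff_norm(2)[OF s, of n] unfolding d_def by (intro mult_left_mono) auto
  also have "1 / 4 ^ n + 17 / 4 ^ k * (8 * 4 ^ i / 4 ^ n) = (1 + 136 * (4 ^ i / 4 ^ k)) / (4 ^ n :: real)"
    by (simp add: add_divide_distrib)
  finally show ?thesis by (simp add: divide_le_cancel)
qed

text \<open>If the addresses coincide or first differ below position \<open>k\<close>, they are
  within 137 and the whole interval of angles is charged. Otherwise transversality places all
  overlap angles within \<open>4 / 4 ^ i\<close> of any one of them.\<close>

lemma measure_overlap_angles_le: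
  assumes k: "1 \<le> k" and r: "r \<ge> 100" "4 / r \<le> 16 / 4 ^ k" and m: "m < 4 ^ n" "m' < 4 ^ n"
  defines "I \<equiv> {arctan (1/2)..arctan (1/2) + 1 / 4 ^ k}"
  shows "measure lebesgue (overlap_angles r n m m' \<inter> I)
    \<le> of_bool (\<bar>int m - int m'\<bar> \<le> int 137) * (1 / 4 ^ k)
      + (\<Sum>i\<in>{k..<n}. of_bool (split_at i m m' \<and> \<bar>int m - int m'\<bar> \<le> int (137 * 4 ^ (i - k))) * (8 / 4 ^ i))"
    (is "?M \<le> ?A + ?B")
proof (cases "overlap_angles r n m m' \<inter> I = {}")
  case True
  then show ?thesis by (simp add: sum_nonneg)
next
  case False
  then obtain \<theta> where \<theta>: "\<theta> \<in> overlap_angles r n m m'" "\<theta> \<in> I" by blast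
  have B0: "?B \<ge> 0" by (simp add: sum_nonneg)
  have meas: "overlap_angles r n m m' \<inter> I \<in> lmeasurable"
    unfolding I_def by (intro lmeasurable_compact closed_Int_compact closed_overlap_angles compact_Icc)
  have "?M \<le> measure lebesgue I"
    using meas by (intro measure_mono_fmeasurable) (auto simp: I_def fmeasurableD)
  then have triv: "?M \<le> 1 / 4 ^ k" by (simp add: I_def)
  have small: ?thesis if "\<bar>int m - int m'\<bar> \<le> int 137"
    using triv that B0 by simp
  show ?thesis
  proof (cases "m = m'")
    case True
    then show ?thesis using small by simp
  next
    case False
    then obtain i where i: "i < n" "split_at i m m'" using split_at_exists[OF m] by blast
    have close: "\<bar>real m - real m'\<bar> \<le> 1 + 136 * (4 ^ i / 4 ^ k)"
      using overlap_angles_index_close[OF r m i(2) \<theta>(1)] \<theta>(2) unfolding I_def by blast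
    show ?thesis
    proof (cases "i < k")
      case True
      then have "4 ^ i / 4 ^ k \<le> (1 :: real)" by simp
      then have "\<bar>real m - real m'\<bar> \<le> 137" using close by linarith
      then show ?thesis using small by linarith
    next
      case False
      then have ik: "k \<le> i" by simp
      have "(4 :: real) ^ i / 4 ^ k = 4 ^ (i - k)" using ik by (simp add: power_diff)
      moreover have "(1 :: real) \<le> 4 ^ (i - k)" by simp
      ultimately have "\<bar>real m - real m'\<bar> \<le> 137 * 4 ^ (i - k)" using close by linarith
      then have "real_of_int \<bar>int m - int m'\<bar> \<le> real_of_int (int (137 * 4 ^ (i - k)))" by simp
      then have cl: "\<bar>int m - int m'\<bar> \<le> int (137 * 4 ^ (i - k))" by (simp only: of_int_le_iff)
      define D where "D = norm (corner n m - corner n m')"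
      have D: "2 * 4 ^ i / 4 ^ n \<le> D" unfolding D_def by (rule corner_diff_norm(1)[OF i(2)])
      \<comment> \<open>\<open>k \<ge> 1\<close> makes the corners at least \<open>8 / 4 ^ n\<close>
        apart, as transversality with tolerance \<open>1 / 4 ^ n\<close> requires.\<close>
      have "(4 :: real) ^ 1 \<le> 4 ^ i" using k ik by (intro power_increasing) auto
      then have "8 / 4 ^ n \<le> 2 * 4 ^ i / (4 ^ n :: real)" by (intro divide_right_mono) auto
      then have D8: "1 / 4 ^ n \<le> D / 8" using D by linarith
      have Dpos: "D > 0" using D by (rule less_le_trans[rotated]) simp
      have "overlap_angles r n m m' \<inter> I \<subseteq> {\<theta> - 4 / 4 ^ i..\<theta> + 4 / 4 ^ i}"
      proof
        fix t assume t: "t \<in> overlap_angles r n m m' \<inter> I"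
        have "(4 :: real) ^ 1 \<le> 4 ^ k" using k by (intro power_increasing) auto
        then have "1 / 4 ^ k \<le> 1 / (4 :: real)" by (intro divide_left_mono) auto
        then have I4: "\<bar>s - t\<bar> \<le> 1/4" if "s \<in> I" "t \<in> I" for s t
          using that unfolding I_def atLeastAtMost_iff by linarith
        have "\<bar>\<theta> - t\<bar> * D \<le> 8 * (1 / 4 ^ n)"
          unfolding D_def
          by (rule circ_proj_transversal[OF r(1) corner_norm_le[OF m(1)] corner_norm_le[OF m(2)], of _ I])
             (use D8 I4 \<theta> t in \<open>auto simp: D_def overlap_angles_def I_def\<close>)
        moreover have "\<bar>\<theta> - t\<bar> * (2 * 4 ^ i / 4 ^ n) \<le> \<bar>\<theta> - t\<bar> * D" using D by (intro mult_left_mono) auto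
        ultimately have "\<bar>\<theta> - t\<bar> * (2 * 4 ^ i / 4 ^ n) \<le> 8 * (1 / 4 ^ n)" by (rule order_trans[rotated])
        then have "\<bar>\<theta> - t\<bar> \<le> 4 / 4 ^ i" by (simp add: field_simps)
        then show "t \<in> {\<theta> - 4 / 4 ^ i..\<theta> + 4 / 4 ^ i}" by auto
      qed
      then have "?M \<le> measure lebesgue {\<theta> - 4 / 4 ^ i..\<theta> + 4 / 4 ^ i}"
        using meas by (intro measure_mono_fmeasurable) (auto simp: fmeasurableD)
      also have "\<dots> = 8 / 4 ^ i" by simp
      also have "\<dots> = of_bool (split_at i m m' \<and> \<bar>int m - int m'\<bar> \<le> int (137 * 4 ^ (i - k))) * (8 / 4 ^ i)"
        using i cl by simp
      also have "\<dots> \<le> ?B" using i ik by (intro member_le_sum) auto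
      finally show ?thesis by (rule order_trans) simp
    qed
  qed
qed

lemma sum_of_bool_card:
  assumes "finite A"
  shows "(\<Sum>(a, b)\<in>A \<times> A. of_bool (P a b) * c) = real (card {(a, b). a \<in> A \<and> b \<in> A \<and> P a b}) * c"
proof -
  have "(\<Sum>(a, b)\<in>A \<times> A. of_bool (P a b) * c) = (\<Sum>p\<in>A \<times> A. of_bool (P (fst p) (snd p))) * c"
    by (simp add: case_prod_beta sum_distrib_right)
  also have "(\<Sum>p\<in>A \<times> A. of_bool (P (fst p) (snd p))) = real (card (A \<times> A \<inter> {p. P (fst p) (snd p)}))"
    using assms by simp
  also have "A \<times> A \<inter> {p. P (fst p) (snd p)} = {(a, b). a \<in> A \<and> b \<in> A \<and> P a b}" by auto
  finally show ?thesis .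
qed

text \<open>Close pairs number at most \<open>275 * 4 ^ n\<close>, with
  \<open>275 = 2 * 137 + 1\<close>. Each scale \<open>i\<close> has the same bound,
  \<open>304704 = 2 * 8 * 138\<^sup>2\<close> times \<open>4 ^ n / 16 ^ k\<close>, and there are at
  most \<open>n\<close> scales.\<close>

lemma sum_measure_overlap_angles_le:
  assumes k: "1 \<le> k" "4 ^ k \<le> n" and r: "r \<ge> 100" "4 / r \<le> 16 / 4 ^ k"
  defines "I \<equiv> {arctan (1/2)..arctan (1/2) + 1 / 4 ^ k}"
  shows "1 / 4 ^ n * (\<Sum>(m, m')\<in>{..<4 ^ n} \<times> {..<4 ^ n}. measure lebesgue (overlap_angles r n m m' \<inter> I))
    \<le> 10 ^ 6 * real n / 16 ^ k"
proof -
  let ?N = "{..<4 ^ n :: nat}"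
  let ?P = "\<lambda>i m m'. split_at i m m' \<and> \<bar>int m - int m'\<bar> \<le> int (137 * 4 ^ (i - k))"
  have "(\<Sum>(m, m')\<in>?N \<times> ?N. measure lebesgue (overlap_angles r n m m' \<inter> I))
    \<le> (\<Sum>(m, m')\<in>?N \<times> ?N. of_bool (\<bar>int m - int m'\<bar> \<le> int 137) * (1 / 4 ^ k)
      + (\<Sum>i\<in>{k..<n}. of_bool (?P i m m') * (8 / 4 ^ i)))"
    unfolding I_def by (intro sum_mono) (use measure_overlap_angles_le[OF k(1) r] in auto)
  also have "\<dots> = (\<Sum>(m, m')\<in>?N \<times> ?N. of_bool (\<bar>int m - int m'\<bar> \<le> int 137) * (1 / 4 ^ k))
      + (\<Sum>i\<in>{k..<n}. \<Sum>(m, m')\<in>?N \<times> ?N. of_bool (?P i m m') * (8 / 4 ^ i))"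
    unfolding case_prod_beta sum.distrib by (subst sum.swap[of _ "{k..<n}"]) simp
  also have "\<dots> \<le> real (4 ^ n * 275) * (1 / 4 ^ k) + (\<Sum>i\<in>{k..<n}. 4 ^ n * 304704 / 16 ^ k)"
  proof (intro add_mono sum_mono)
    have "card {(a, b). a \<in> ?N \<and> b \<in> ?N \<and> \<bar>int a - int b\<bar> \<le> int 137} \<le> 4 ^ n * 275"
      using card_close_pairs_le[of "4 ^ n" 137] by simp
    then have "real (card {(a, b). a \<in> ?N \<and> b \<in> ?N \<and> \<bar>int a - int b\<bar> \<le> int 137}) \<le> real (4 ^ n * 275)"
      by (simp only: of_nat_le_iff)
    then show "(\<Sum>(m, m')\<in>?N \<times> ?N. of_bool (\<bar>int m - int m'\<bar> \<le> int 137) * (1 / 4 ^ k))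
        \<le> real (4 ^ n * 275) * (1 / 4 ^ k)"
      unfolding sum_of_bool_card[OF finite_lessThan] by (rule mult_right_mono) simp
  next
    fix i assume i: "i \<in> {k..<n}"
    have "card {(a, b). a \<in> ?N \<and> b \<in> ?N \<and> ?P i a b} \<le> 2 * (4 ^ (n - i) * (137 * 4 ^ (i - k) + 1) ^ 2)"
      using card_split_at_le[of i n "137 * 4 ^ (i - k)"] i by simp
    also have "\<dots> \<le> 2 * (4 ^ (n - i) * (138 * 4 ^ (i - k)) ^ 2)"
      by (intro mult_left_mono power_mono) auto
    finally have "real (card {(a, b). a \<in> ?N \<and> b \<in> ?N \<and> ?P i a b})
        \<le> real (2 * (4 ^ (n - i) * (138 * 4 ^ (i - k)) ^ 2))"
      by (simp only: of_nat_le_iff)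
    then have "(\<Sum>(m, m')\<in>?N \<times> ?N. of_bool (?P i m m') * (8 / 4 ^ i))
        \<le> real (2 * (4 ^ (n - i) * (138 * 4 ^ (i - k)) ^ 2)) * (8 / 4 ^ i)"
      unfolding sum_of_bool_card[OF finite_lessThan] by (rule mult_right_mono) simp
    also have "\<dots> = 304704 * (4 ^ (n - i) * (4 ^ (i - k)) ^ 2 / 4 ^ i)" by (simp add: power_mult_distrib)
    \<comment> \<open>The pair count \<open>4 ^ (n - i) * 16 ^ (i - k)\<close> and the angle measure
      \<open>1 / 4 ^ i\<close> balance, so \<open>i\<close> drops out.\<close>
    also have "4 ^ (n - i) * (4 ^ (i - k)) ^ 2 / 4 ^ i = (4 ^ n / 16 ^ k :: real)"
    proof -
      have "(16 :: real) ^ k = 4 ^ k * 4 ^ k" by (simp flip: power_mult_distrib)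
      then show ?thesis using i by (simp add: power_diff power2_eq_square)
    qed
    finally show "(\<Sum>(m, m')\<in>?N \<times> ?N. of_bool (?P i m m') * (8 / 4 ^ i)) \<le> (4 ^ n * 304704 / 16 ^ k :: real)"
      by (simp add: mult.commute)
  qed
  also have "\<dots> = 4 ^ n * (275 * 4 ^ k / 16 ^ k + real (n - k) * 304704 / 16 ^ k)"
  proof -
    have "(16 :: real) ^ k = 4 ^ k * 4 ^ k" by (simp flip: power_mult_distrib)
    then show ?thesis by (simp add: field_simps)
  qed
  \<comment> \<open>\<open>4 ^ k \<le> n\<close> absorbs the close pairs into the bound for the
    scales.\<close>
  also have "\<dots> \<le> 4 ^ n * (275 * real n / 16 ^ k + real n * 304704 / 16 ^ k)"
  proof -
    have "real (4 ^ k) \<le> real n" using k(2) by (simp only: of_nat_le_iff)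
    then show ?thesis by (intro mult_left_mono add_mono divide_right_mono mult_right_mono) auto
  qed
  also have "\<dots> \<le> 4 ^ n * (10 ^ 6 * real n / 16 ^ k)"
    by (intro mult_left_mono) (auto simp flip: add_divide_distrib intro!: divide_right_mono)
  finally show ?thesis by (simp add: field_simps)
qed

section \<open>Summation over shells of angles\<close>

lemma integral_measure_circ_proj_shell_ge:
  assumes k: "1 \<le> k" "4 ^ k \<le> n" and r: "r \<ge> 100" "4 / r \<le> 16 / 4 ^ k"
  shows "integral {arctan (1/2) + 1 / 4 ^ Suc k..arctan (1/2) + 1 / 4 ^ k}
      (\<lambda>\<theta>. measure lebesgue (circ_proj r \<theta> ` K_stage n)) \<ge> 1 / (2 * 10 ^ 6 * real n)"
proof -
  let ?u = "arctan (1/2) + 1 / 4 ^ Suc k" and ?v = "arctan (1/2) + 1 / 4 ^ k :: real"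
  define S where "S = (\<Sum>(m, m')\<in>{..<4 ^ n} \<times> {..<4 ^ n}. measure lebesgue (overlap_angles r n m m' \<inter> {?u..?v}))"
  \<comment> \<open>With this \<open>L\<close> the quadratic term is at most
    \<open>1 / (10 ^ 6 * n)\<close>, while the shell length \<open>3/4 / 4 ^ k\<close> makes the
    linear term \<open>3/2\<close> times that, so half of it remains.\<close>
  define L where "L = 10 ^ 6 * real n / 4 ^ k"
  have n: "n > 0" using k(2) by (metis gr0I le_zero_eq power_not_zero zero_neq_numeral)
  have L: "L > 0" using n by (simp add: L_def)
  have "arctan (1/2) \<ge> 0" by (simp add: arctan_less_iff zero_le_arctan_iff)
  moreover have "arctan (1/2) \<le> 1/2" by (rule arctan_le_self) simp
  moreover have "1 / 4 ^ k \<le> (1 :: real)" by simp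
  moreover have "1 / 4 ^ Suc k \<le> (1 / 4 ^ k :: real)" "(0 :: real) \<le> 1 / 4 ^ Suc k" by (simp_all add: field_simps)
  ultimately have uv: "0 \<le> ?u" "?u \<le> ?v" "?v \<le> pi / 2" using pi_gt3 by linarith+
  have "S \<le> (\<Sum>(m, m')\<in>{..<4 ^ n} \<times> {..<4 ^ n}. measure lebesgue (overlap_angles r n m m' \<inter> {arctan (1/2)..?v}))"
    unfolding S_def
  proof (intro sum_mono, clarify)
    fix m m'
    show "measure lebesgue (overlap_angles r n m m' \<inter> {?u..?v}) \<le> measure lebesgue (overlap_angles r n m m' \<inter> {arctan (1/2)..?v})"
      by (intro measure_mono_fmeasurable fmeasurableD lmeasurable_compact closed_Int_compact
          closed_overlap_angles compact_Icc) auto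
  qed
  then have "1 / 4 ^ n * S \<le> 1 / 4 ^ n *
      (\<Sum>(m, m')\<in>{..<4 ^ n} \<times> {..<4 ^ n}. measure lebesgue (overlap_angles r n m m' \<inter> {arctan (1/2)..?v}))"
    by (intro mult_left_mono) auto
  also have "\<dots> \<le> 10 ^ 6 * real n / 16 ^ k"
    by (rule sum_measure_overlap_angles_le[OF k r])
  finally have "1 / L\<^sup>2 * (1 / 4 ^ n * S) \<le> 1 / L\<^sup>2 * (10 ^ 6 * real n / 16 ^ k)"
    by (intro mult_left_mono) auto
  also have "\<dots> = 1 / (10 ^ 6 * real n)"
  proof -
    have "(16 :: real) ^ k = 4 ^ k * 4 ^ k" by (simp flip: power_mult_distrib)
    then show ?thesis using n by (simp add: L_def power2_eq_square field_simps)
  qed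
  finally have S: "1 / L\<^sup>2 * (1 / 4 ^ n * S) \<le> 1 / (10 ^ 6 * real n)" .
  have "1 / (2 * 10 ^ 6 * real n) = (3 / 2) * (1 / (10 ^ 6 * real n)) - 1 / (10 ^ 6 * real n)"
    by (simp add: field_simps)
  also have "(3 / 2) * (1 / (10 ^ 6 * real n)) = 2 / L * (?v - ?u)"
    using n by (simp add: L_def field_simps)
  also have "2 / L * (?v - ?u) - 1 / (10 ^ 6 * real n) \<le> 2 / L * (?v - ?u) - 1 / L\<^sup>2 * (1 / 4 ^ n * S)"
    using S by (rule diff_left_mono)
  also have "\<dots> \<le> integral {?u..?v} (\<lambda>\<theta>. measure lebesgue (circ_proj r \<theta> ` K_stage n))"
    unfolding S_def by (rule integral_measure_circ_proj_ge[OF uv L])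
  finally show ?thesis .
qed

text \<open>The shells for \<open>k = 1, ..., K\<close> are adjacent and share one lower bound; the
  condition on \<open>r\<close> for \<open>K\<close> implies those for smaller
  \<open>k\<close>.\<close>

lemma integral_measure_circ_proj_shells_ge:
  assumes K: "4 ^ K \<le> n" and r: "r \<ge> 100" "4 / r \<le> 16 / 4 ^ K"
  shows "integral {arctan (1/2) + 1 / 4 ^ Suc K..arctan (1/2) + 1/4}
      (\<lambda>\<theta>. measure lebesgue (circ_proj r \<theta> ` K_stage n)) \<ge> real K / (2 * 10 ^ 6 * real n)"
  using K r(2)
proof (induction K)
  case 0
  then show ?case by simp
next
  case (Suc K)
  let ?F = "\<lambda>\<theta>. measure lebesgue (circ_proj r \<theta> ` K_stage n)"
  let ?a = "arctan (1/2) + 1 / 4 ^ Suc (Suc K)" and ?c = "arctan (1/2) + 1 / 4 ^ Suc K" and ?b = "arctan (1/2) + 1/4 :: real"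
  have "16 / 4 ^ Suc K \<le> (16 / 4 ^ K :: real)" by (simp add: field_simps)
  moreover have "4 ^ K \<le> n" using Suc.prems(1) by simp
  ultimately have "integral {?c..?b} ?F \<ge> real K / (2 * 10 ^ 6 * real n)"
    using Suc.prems by (intro Suc.IH) auto
  moreover have "integral {?a..?c} ?F \<ge> 1 / (2 * 10 ^ 6 * real n)"
    using Suc.prems by (intro integral_measure_circ_proj_shell_ge r) auto
  moreover have "integral {?a..?c} ?F + integral {?c..?b} ?F = integral {?a..?b} ?F"
    by (intro Henstock_Kurzweil_Integration.integral_combine measure_circ_proj_integrable_on compact_K_stage)
       (auto simp: field_simps)
  ultimately show ?case by (simp add: add_divide_distrib)
qed

section \<open>Favard length and the final constant\<close>

lemma Fav_sigma_map: "Fav (sigma_map r) (K_stage n) =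
    1 / (2 * pi) * integral {0..2 * pi} (\<lambda>\<theta>. measure lebesgue (circ_proj r \<theta> ` K_stage n))"
  unfolding Fav_def proj_length_def image_image proj_coord_sigma_map ..

lemma Fav_sigma_map_ge:
  assumes "0 \<le> u" "v \<le> 2 * pi"
  shows "Fav (sigma_map r) (K_stage n)
    \<ge> 1 / (2 * pi) * integral {u..v} (\<lambda>\<theta>. measure lebesgue (circ_proj r \<theta> ` K_stage n))"
  unfolding Fav_sigma_map using assms
  by (intro mult_left_mono integral_subset_le measure_circ_proj_integrable_on compact_K_stage) auto

text \<open>This serves the finitely many small \<open>n\<close>: a single square already projects
  to length at least \<open>1 / 4 ^ n\<close> for all angles in \<open>{0..1}\<close>.\<close>

lemma Fav_sigma_map_pos: "Fav (sigma_map r) (K_stage n) > 0"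
proof -
  have "(1 / 4 ^ n :: real) \<le> measure lebesgue (circ_proj r \<theta> ` K_stage n)" if "\<theta> \<in> {0..1}" for \<theta>
  proof -
    let ?U = "\<Union>m<4 ^ n. {circ_proj r \<theta> (corner n m)..circ_proj r \<theta> (corner n m) + 1 / 4 ^ n}"
    have "measure lebesgue {circ_proj r \<theta> (corner n 0)..circ_proj r \<theta> (corner n 0) + 1 / 4 ^ n}
        \<le> measure lebesgue ?U"
      by (intro measure_mono_fmeasurable fmeasurable.finite_UN) (auto intro!: bexI[of _ 0])
    also have "\<dots> \<le> measure lebesgue (circ_proj r \<theta> ` K_stage n)"
      using that pi_gt3 by (intro measure_circ_proj_ge) auto
    finally show ?thesis by simp
  qed
  then have "integral {0..1 :: real} (\<lambda>_. 1 / 4 ^ n)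
      \<le> integral {0..1} (\<lambda>\<theta>. measure lebesgue (circ_proj r \<theta> ` K_stage n))"
    by (intro integral_le measure_circ_proj_integrable_on compact_K_stage) auto
  then have "1 / (2 * pi) * (1 / 4 ^ n)
      \<le> 1 / (2 * pi) * integral {0..1} (\<lambda>\<theta>. measure lebesgue (circ_proj r \<theta> ` K_stage n))"
    by (intro mult_left_mono) auto
  also have "\<dots> \<le> Fav (sigma_map r) (K_stage n)"
    using pi_gt3 by (intro Fav_sigma_map_ge) auto
  finally show ?thesis by (rule less_le_trans[rotated]) simp
qed

text \<open>It follows from \<open>exp x \<ge> x\<close> and
  \<open>ln 4 / 5 \<ge> 4 / 15 \<ge> 1 / 4\<close>.\<close>

lemma four_powr_fifth_ge: "4 powr (real n / 5) \<ge> real n / 4"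
proof -
  have "ln (4 :: real) = 2 * ln 2" using ln_realpow[of 2 2] by simp
  then have "ln (4 :: real) \<ge> 4 / 3" using ln2_ge_two_thirds by simp
  then have "real n / 4 \<le> real n / 5 * ln 4" by (simp add: field_simps) (use mult_left_mono[of "5/4" "ln 4" "real n"] in auto)
  also have "\<dots> \<le> exp (real n / 5 * ln 4)" using exp_ge_add_one_self[of "real n / 5 * ln 4"] by linarith
  finally show ?thesis by (simp add: powr_def)
qed

text \<open>\<open>n \<ge> 400\<close> gives \<open>r \<ge> n / 4 \<ge> 100\<close>. With
  \<open>K\<close> the integer part of \<open>log 4 n\<close>, the chain
  \<open>4 ^ K \<le> n \<le> 4 * r\<close> is the curvature condition
  \<open>4 / r \<le> 16 / 4 ^ K\<close>, so \<open>K\<close> shells contribute.\<close>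

lemma Fav_sigma_map_log_ge:
  assumes n: "n \<ge> 400" and r: "r \<ge> 4 powr (real n / 5)"
  shows "Fav (sigma_map r) (K_stage n) \<ge> 1 / (8 * pi * 10 ^ 6 * ln 4) * ln (real n) / real n"
proof -
  have "\<exists>K. 4 ^ K \<le> n \<and> n < 4 ^ (K + 1)"
    using ex_power_ivl1[of 4 n] n by auto
  then obtain K where K: "4 ^ K \<le> n" "n < 4 ^ Suc K" by auto
  have r4: "r \<ge> real n / 4" using four_powr_fifth_ge[of n] r by linarith
  then have r100: "r \<ge> 100" using n by linarith
  have Kn: "real (4 ^ K) \<le> real n" "real n < real (4 ^ Suc K)" using K by (simp_all only: of_nat_le_iff of_nat_less_iff)
  have "4 ^ K \<le> 4 * r" using r4 Kn(1) unfolding of_nat_power of_nat_numeral by linarith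
  then have "4 / r \<le> 16 / 4 ^ K" using r100 by (simp add: field_simps)
  then have "real K / (2 * 10 ^ 6 * real n) \<le>
      integral {arctan (1/2) + 1 / 4 ^ Suc K..arctan (1/2) + 1/4} (\<lambda>\<theta>. measure lebesgue (circ_proj r \<theta> ` K_stage n))"
    by (rule integral_measure_circ_proj_shells_ge[OF K(1) r100])
  then have "1 / (2 * pi) * (real K / (2 * 10 ^ 6 * real n)) \<le> 1 / (2 * pi) *
      integral {arctan (1/2) + 1 / 4 ^ Suc K..arctan (1/2) + 1/4} (\<lambda>\<theta>. measure lebesgue (circ_proj r \<theta> ` K_stage n))"
    by (intro mult_left_mono) auto
  also have "\<dots> \<le> Fav (sigma_map r) (K_stage n)"
  proof (rule Fav_sigma_map_ge)
    show "0 \<le> arctan (1/2) + 1 / 4 ^ Suc K" by (simp add: zero_le_arctan_iff)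
    show "arctan (1/2) + 1/4 \<le> 2 * pi" using arctan_le_self[of "1/2"] pi_gt3 by simp
  qed
  finally have 1: "1 / (2 * pi) * (real K / (2 * 10 ^ 6 * real n)) \<le> Fav (sigma_map r) (K_stage n)" .
  \<comment> \<open>Since \<open>K \<ge> 1\<close>, \<open>K + 1 \<le> 2 * K\<close>; this factor 2
    turns \<open>4 * pi\<close> into \<open>8 * pi\<close> in the constant.\<close>
  have "K \<noteq> 0" using K n by (cases K) auto
  have "ln (real n) \<le> ln (4 ^ Suc K)" using Kn(2) n by (intro ln_mono) auto
  also have "\<dots> = real (Suc K) * ln 4" by (rule ln_realpow)
  also have "\<dots> \<le> (2 * real K) * ln 4" using \<open>K \<noteq> 0\<close> by (intro mult_right_mono) auto
  finally have "ln (real n) / ln 4 \<le> 2 * real K" by (simp add: field_simps)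
  then have "1 / (8 * pi * 10 ^ 6 * real n) * (ln (real n) / ln 4) \<le> 1 / (8 * pi * 10 ^ 6 * real n) * (2 * real K)"
    by (intro mult_left_mono) auto
  then show ?thesis using 1 by (simp add: ac_simps)
qed

theorem theorem2:
  fixes r :: "nat \<Rightarrow> real"
  assumes "\<forall>n\<ge>1. r n \<ge> 4 powr (real n / 5)"
  shows "undercooked r"
proof -
  define g where "g = (\<lambda>n. Fav (sigma_map (r n)) (K_stage n))"
  \<comment> \<open>For \<open>n < 400\<close>, \<open>ln n / n \<le> 1\<close>, so it suffices that
    \<open>c\<close> is at most each of these finitely many positive values.\<close>
  define c where "c = Min (insert (1 / (8 * pi * 10 ^ 6 * ln 4)) (g ` {..<400}))"
  have c: "c > 0" unfolding c_def by (subst Min_gr_iff) (auto simp: g_def Fav_sigma_map_pos)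
  have "c * ln (real n) / real n \<le> g n" if n: "n \<ge> 2" for n
  proof (cases "n < 400")
    case True
    then have "c \<le> g n" unfolding c_def by (intro Min_le) auto
    moreover have "c * (ln (real n) / real n) \<le> c * 1"
      using c n ln_less_self[of "real n"] by (intro mult_left_mono) (auto simp: less_imp_le)
    ultimately show ?thesis by simp
  next
    case False
    have "c \<le> 1 / (8 * pi * 10 ^ 6 * ln 4)" unfolding c_def by (intro Min_le) auto
    then have "c * (ln (real n) / real n) \<le> 1 / (8 * pi * 10 ^ 6 * ln 4) * (ln (real n) / real n)"
      using n by (intro mult_right_mono) auto
    also have "\<dots> \<le> g n"
      using Fav_sigma_map_log_ge[of n "r n"] False assms n unfolding g_def by simp
    finally show ?thesis by simp
  qed
  then show ?thesis using c unfolding undercooked_def undercooking_def g_def by blast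
qed

end
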